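(* Let $\hat n:(0,1)\to(0,\infty)$ be piecewise smooth (on $(0,\xi)$ and $(\xi,1)$) and bounded from above and below by positive numbers. Let $k_\infty$ with $\operatorname{Im}k_\infty<0$ be a resonance, let $m\in\mathbb{Z}$, and let $\omega_{k_\infty}\subset\{k\in\mathbb{C}:\operatorname{Im}k<0\}$ be a neighborhood of $k_\infty$ such that for every $k\in\omega_{k_\infty}$ the problems (F1) and (F2) have unique solutions $f_{1,1,k}$ and $f_{2,2,k}$. Then the function $\det:\omega_{k_\infty}\to\mathbb{C}$, $$\det(k)=-\bigl[f_{1,1,k}(\xi)f_{2,2,k}'(\xi)-f_{1,1,k}'(\xi)f_{2,2,k}(\xi)\bigr]$$ $$=ik(\hat n_2(\xi)+\hat n_1(\xi))f_{1,1,k}(\xi)f_{2,2,k}(\xi)+h_{2,2,k}f_{1,1,k}(\xi)+h_{1,1,k}f_{2,2,k}(\xi),$$ is analytic. If $k_\infty\neq0$ is a simple root of $\det$, then there exists $\delta>0$ such that for any starting point $k_0\in B(k_\infty,\delta)$ the sequence $$k_{l+1}=k_l-\frac{\det(k_l)}{\partial_k\det(k_l)}$$ converges to $k_\infty$, and the convergence is quadratic.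
   Context: Fix $\xi\in(0,1)$ and set $\tau_1=(0,\xi)$, $\tau_2=(\xi,1)$, $\Omega=\{x\in\mathbb{R}^2:|x|<1\}$, $\Omega_j=\{x\in\mathbb{R}^2:|x|\in\tau_j\}$, $\gamma_\xi=\{|x|=\xi\}$, $\gamma_1=\partial\Omega$. Write $\hat n_j=\hat n|_{\tau_j}$, which is $C^\infty$ on $\tau_j$ and Lipschitz continuous there; endpoint values are one-sided limits, so $\hat n(1)=\hat n_2(1)$. Put $n(x)=\hat n(|x|)$. $B(k_\infty,\delta)\subset\mathbb{C}$ is the open disc. $H_m=H_m^{(1)}$ is the Hankel function of the first kind and order $m$ (principal branch); $\mathcal{Z}=\{z\in\mathbb{C}\mid\exists m\in\mathbb{Z}:H_m(z)=0\}$. Wavenumbers $k$ are assumed to satisfy $k\hat n(1)\notin\mathcal{Z}$. For $\varphi=\sum_m\varphi_me^{im\theta}$ on $\gamma_1$, $T_\kappa\varphi=\sum_m\kappa\frac{H_m'(\kappa)}{H_m(\kappa)}\varphi_me^{im\theta}$. A resonance is a $k\in\mathbb{C}\setminus\{0\}$ for which there is $u\in H^1(\Omega)\setminus\{0\}$ with $-\Delta u=(kn)^2u$ in $\Omega_1\cup\Omega_2$, $[u]_{\gamma_\xi}=[\nabla u\cdot\nu]_{\gamma_\xi}=0$ and $\partial u/\partial\nu=T_{k\hat n(1)}u$ on $\gamma_1$, where $[\cdot]_{\gamma_\xi}$ is the jump across $\gamma_\xi$ and $\nu$ the normal. For fixed $m\in\mathbb{Z}$ (suppressed in the notation), $$L_{j,k}v=-\frac1r(rv')'+\Bigl(\frac{m^2}{r^2}-(k\hat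 n_j)^2\Bigr)v\ \text{ in }\tau_j,\quad B_1(0)v=\begin{cases}v(0)&m\text{ odd}\\ v'(0)&m\text{ even}\end{cases},\quad \beta_{2,k}(1)=k\hat n_2(1)\frac{H_m'(k\hat n_2(1))}{H_m(k\hat n_2(1))}.$$ Given nonzero data $h_{1,1,k},h_{2,2,k}\in\mathbb{C}$ that are complex-differentiable functions of $k$, the problems are (F1) $L_{1,k}f_{1,1,k}=0$ in $\tau_1$, $\ B_1(0)f_{1,1,k}=0$, $\ f_{1,1,k}'(\xi)-ik\hat n_1(\xi)f_{1,1,k}(\xi)=h_{1,1,k}\ne0$; (F2) $L_{2,k}f_{2,2,k}=0$ in $\tau_2$, $\ -f_{2,2,k}'(\xi)-ik\hat n_2(\xi)f_{2,2,k}(\xi)=h_{2,2,k}\ne0$, $\ f_{2,2,k}'(1)-\beta_{2,k}(1)f_{2,2,k}(1)=0$. Solutions are sought in $H^1(\tau_1)$ and $H^1(\tau_2)$ respectively. The functions $\det$ and $\partial_k\det$ are evaluated with the exact solutions $f_{1,1,k},f_{2,2,k}$. Here $'$ is the derivative in $r$ and $\partial_k$ the complex derivative in $k$. *)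

theory Defs
  imports "HOL-Complex_Analysis.Complex_Analysis"
begin

section \<open>Smooth functions, weak derivatives and the Sobolev space \<open>H\<^sup>1\<close>\<close>

text \<open>\<open>Ck_on\<close> is only meant for open sets, where \<^term>\<open>f differentiable_on S\<close>
  is differentiability at every point of \<^term>\<open>S\<close>.\<close>

primrec Ck_on ::
    "nat \<Rightarrow> 'a::euclidean_space set \<Rightarrow> ('a \<Rightarrow> 'b::real_normed_vector) \<Rightarrow> bool" where
  "Ck_on 0 S f \<longleftrightarrow> continuous_on S f"
| "Ck_on (Suc n) S f \<longleftrightarrow>
     f differentiable_on S \<and> (\<forall>i\<in>Basis. Ck_on n S (\<lambda>x. frechet_derivative f (at x) i))"

definition smooth_on ::
    "'a::euclidean_space set \<Rightarrow> ('a \<Rightarrow> 'b::real_normed_vector) \<Rightarrow> bool" where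
  "smooth_on S f \<longleftrightarrow> (\<forall>n. Ck_on n S f)"

definition test_function :: "'a::euclidean_space set \<Rightarrow> ('a \<Rightarrow> real) \<Rightarrow> bool" where
  "test_function S \<phi> \<longleftrightarrow>
     smooth_on UNIV \<phi> \<and> (\<exists>K. compact K \<and> K \<subseteq> S \<and> (\<forall>x. x \<notin> K \<longrightarrow> \<phi> x = 0))"

definition L2_on :: "'a::euclidean_space set \<Rightarrow> ('a \<Rightarrow> complex) \<Rightarrow> bool" where
  "L2_on S f \<longleftrightarrow> set_borel_measurable lebesgue S f \<and>
     set_integrable lebesgue S (\<lambda>x. (norm (f x))\<^sup>2)"

definition weak_partial ::
    "'a::euclidean_space set \<Rightarrow> 'a \<Rightarrow> ('a \<Rightarrow> complex) \<Rightarrow> ('a \<Rightarrow> complex) \<Rightarrow> bool" where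
  "weak_partial S i f g \<longleftrightarrow> (\<forall>\<phi>. test_function S \<phi> \<longrightarrow>
     (LINT x:S|lebesgue. frechet_derivative \<phi> (at x) i *\<^sub>R f x) =
       - (LINT x:S|lebesgue. \<phi> x *\<^sub>R g x))"

definition H1_on :: "'a::euclidean_space set \<Rightarrow> ('a \<Rightarrow> complex) \<Rightarrow> bool" where
  "H1_on S f \<longleftrightarrow> L2_on S f \<and> (\<forall>i\<in>Basis. \<exists>g. L2_on S g \<and> weak_partial S i f g)"


section \<open>Hankel functions of the first kind of integer order\<close>

definition bessel_J :: "nat \<Rightarrow> complex \<Rightarrow> complex" where
  "bessel_J n z = (z / 2) ^ n * (\<Sum>j. (- (z\<^sup>2 / 4)) ^ j / (fact j * fact (n + j)))"

text \<open>The classical expansion of the Bessel function of the second kind of integer order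
  (Abramowitz--Stegun 9.1.11, DLMF 10.8.1). As \<^term>\<open>ln\<close> is the principal logarithm on the
  complex numbers, this is the principal branch, with cut along the negative real axis.\<close>

definition bessel_Y :: "nat \<Rightarrow> complex \<Rightarrow> complex" where
  "bessel_Y n z =
     - inverse ((z / 2) ^ n) / of_real pi *
         (\<Sum>j<n. fact (n - j - 1) / fact j * (z\<^sup>2 / 4) ^ j)
     + 2 / of_real pi * ln (z / 2) * bessel_J n z
     - (z / 2) ^ n / of_real pi *
         (\<Sum>j. (Digamma (of_nat (j + 1)) + Digamma (of_nat (n + j + 1))) *
              (- (z\<^sup>2 / 4)) ^ j / (fact j * fact (n + j)))"

text \<open>For negative orders, \<open>H\<^sub>-\<^sub>n = e\<^sup>i\<^sup>n\<^sup>\<pi> H\<^sub>n = (-1)\<^sup>n H\<^sub>n\<close>.\<close>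

definition hankel1 :: "int \<Rightarrow> complex \<Rightarrow> complex" where
  "hankel1 m z =
     (if 0 \<le> m then 1 else (- 1) ^ nat \<bar>m\<bar>) *
     (bessel_J (nat \<bar>m\<bar>) z + \<i> * bessel_Y (nat \<bar>m\<bar>) z)"

text \<open>The origin is not in the domain of the Hankel functions.\<close>

definition hankel1_zeros :: "complex set" where
  "hankel1_zeros = {z. z \<noteq> 0 \<and> (\<exists>m. hankel1 m z = 0)}"

definition dtn_symbol :: "int \<Rightarrow> complex \<Rightarrow> complex" where
  "dtn_symbol m \<kappa> = \<kappa> * (deriv (hankel1 m) \<kappa> / hankel1 m \<kappa>)"


section \<open>The radial refractive index\<close>

definition admissible_index :: "real \<Rightarrow> (real \<Rightarrow> real) \<Rightarrow> bool" where
  "admissible_index \<xi> nhat \<longleftrightarrow>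
     smooth_on {0<..<\<xi>} nhat \<and> smooth_on {\<xi><..<1} nhat \<and>
     (\<exists>L. L-lipschitz_on {0<..<\<xi>} nhat) \<and> (\<exists>L. L-lipschitz_on {\<xi><..<1} nhat) \<and>
     (\<exists>c C. 0 < c \<and> (\<forall>r\<in>{0<..<1}. c \<le> nhat r \<and> nhat r \<le> C))"

text \<open>The one-sided limits \<open>n\<^sub>1(\<xi>)\<close>, \<open>n\<^sub>2(\<xi>)\<close> and \<open>n\<^sub>2(1)\<close>.\<close>

definition n1_xi :: "real \<Rightarrow> (real \<Rightarrow> real) \<Rightarrow> real" where
  "n1_xi \<xi> nhat = Lim (at_left \<xi>) nhat"

definition n2_xi :: "real \<Rightarrow> (real \<Rightarrow> real) \<Rightarrow> real" where
  "n2_xi \<xi> nhat = Lim (at_right \<xi>) nhat"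

definition n2_one :: "(real \<Rightarrow> real) \<Rightarrow> real" where
  "n2_one nhat = Lim (at_left 1) nhat"


section \<open>Resonances in the unit disc\<close>

definition Omega :: "(real ^ 2) set" where
  "Omega = {x. norm x < 1}"

definition Omega1 :: "real \<Rightarrow> (real ^ 2) set" where
  "Omega1 \<xi> = {x. norm x \<in> {0<..<\<xi>}}"

definition Omega2 :: "real \<Rightarrow> (real ^ 2) set" where
  "Omega2 \<xi> = {x. norm x \<in> {\<xi><..<1}}"

definition laplacian :: "('a::euclidean_space \<Rightarrow> complex) \<Rightarrow> 'a \<Rightarrow> complex" where
  "laplacian u x =
     (\<Sum>i\<in>Basis. frechet_derivative (\<lambda>y. frechet_derivative u (at y) i) (at x) i)"

text \<open>\<^term>\<open>sgn x\<close> is the outer unit normal \<open>x / |x|\<close> of the circle through \<^term>\<open>x\<close>.\<close>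

definition normal_deriv :: "(real ^ 2 \<Rightarrow> complex) \<Rightarrow> real ^ 2 \<Rightarrow> complex" where
  "normal_deriv u x = frechet_derivative u (at x) (sgn x)"

definition circle_coeff :: "(real ^ 2 \<Rightarrow> complex) \<Rightarrow> real \<Rightarrow> int \<Rightarrow> complex" where
  "circle_coeff u r m =
     integral {0..2 * pi} (\<lambda>t. u (vector [r * cos t, r * sin t]) * cis (- of_int m * t))
       / of_real (2 * pi)"

text \<open>Boundary values on a circle \<open>|x| = \<rho>\<close> are taken in the sense of distributions and are
  identified with their sequences of Fourier coefficients. This covers both the traces of
  \<open>H\<^sup>1\<close> functions (in \<open>H\<^sup>1\<^sup>/\<^sup>2\<close>) and their normal derivatives (in \<open>H\<^sup>-\<^sup>1\<^sup>/\<^sup>2\<close>). The filter is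
  \<^term>\<open>at_left \<rho>\<close> or \<^term>\<open>at_right \<rho>\<close>, according to the side of the circle.\<close>

definition has_trace :: "real filter \<Rightarrow> (real ^ 2 \<Rightarrow> complex) \<Rightarrow> (int \<Rightarrow> complex) \<Rightarrow> bool" where
  "has_trace F u \<phi> \<longleftrightarrow> (\<forall>m. ((\<lambda>r. circle_coeff u r m) \<longlongrightarrow> \<phi> m) F)"

definition no_jump :: "real \<Rightarrow> (real ^ 2 \<Rightarrow> complex) \<Rightarrow> bool" where
  "no_jump \<rho> u \<longleftrightarrow> (\<exists>\<phi>. has_trace (at_left \<rho>) u \<phi> \<and> has_trace (at_right \<rho>) u \<phi>)"

definition DtN :: "complex \<Rightarrow> (int \<Rightarrow> complex) \<Rightarrow> (int \<Rightarrow> complex)" where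
  "DtN \<kappa> \<phi> = (\<lambda>m. dtn_symbol m \<kappa> * \<phi> m)"

text \<open>As the index is smooth in \<open>\<Omega>\<^sub>1 \<union> \<Omega>\<^sub>2\<close>, interior elliptic regularity gives every
  \<open>H\<^sup>1\<close> solution a representative that satisfies the equation there pointwise.\<close>

definition resonance :: "real \<Rightarrow> (real \<Rightarrow> real) \<Rightarrow> complex \<Rightarrow> bool" where
  "resonance \<xi> nhat k \<longleftrightarrow> k \<noteq> 0 \<and>
     (\<exists>u. H1_on Omega u \<and> \<not> (AE x in lebesgue. x \<in> Omega \<longrightarrow> u x = 0) \<and>
        Ck_on 2 (Omega1 \<xi> \<union> Omega2 \<xi>) u \<and>
        (\<forall>x\<in>Omega1 \<xi> \<union> Omega2 \<xi>. - laplacian u x = (k * of_real (nhat (norm x)))\<^sup>2 * u x) \<and>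
        no_jump \<xi> u \<and> no_jump \<xi> (normal_deriv u) \<and>
        (\<exists>\<phi>. has_trace (at_left 1) u \<phi> \<and>
             has_trace (at_left 1) (normal_deriv u) (DtN (k * of_real (n2_one nhat)) \<phi>)))"


section \<open>The radial problems on \<open>(0, \<xi>)\<close> and \<open>(\<xi>, 1)\<close>\<close>

abbreviation vderiv :: "(real \<Rightarrow> complex) \<Rightarrow> real \<Rightarrow> complex" where
  "vderiv v r \<equiv> vector_derivative v (at r)"

definition radial_op ::
    "(real \<Rightarrow> real) \<Rightarrow> int \<Rightarrow> complex \<Rightarrow> (real \<Rightarrow> complex) \<Rightarrow> real \<Rightarrow> complex" where
  "radial_op nhat m k v r =
     - (1 / of_real r) * vderiv (\<lambda>s. of_real s * vderiv v s) r
     + ((of_int m)\<^sup>2 / (of_real r)\<^sup>2 - (k * of_real (nhat r))\<^sup>2) * v r"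

text \<open>\<open>H\<^sup>1\<close> solutions of \<open>L v = 0\<close>, again represented by functions that satisfy the equation
  pointwise. They are functions on the open interval; their endpoint values and those of their
  derivatives are one-sided limits.\<close>

definition radial_solution ::
    "real set \<Rightarrow> (real \<Rightarrow> real) \<Rightarrow> int \<Rightarrow> complex \<Rightarrow> (real \<Rightarrow> complex) \<Rightarrow> bool" where
  "radial_solution \<tau> nhat m k v \<longleftrightarrow>
     H1_on \<tau> v \<and> Ck_on 2 \<tau> v \<and> (\<forall>r\<in>\<tau>. radial_op nhat m k v r = 0)"

definition has_endpoint_data ::
    "real filter \<Rightarrow> (real \<Rightarrow> complex) \<Rightarrow> complex \<Rightarrow> complex \<Rightarrow> bool" where
  "has_endpoint_data F v a b \<longleftrightarrow> (v \<longlongrightarrow> a) F \<and> (vderiv v \<longlongrightarrow> b) F"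

definition F1_solution ::
    "real \<Rightarrow> (real \<Rightarrow> real) \<Rightarrow> int \<Rightarrow> complex \<Rightarrow> complex \<Rightarrow> (real \<Rightarrow> complex) \<Rightarrow> bool" where
  "F1_solution \<xi> nhat m k h v \<longleftrightarrow>
     radial_solution {0<..<\<xi>} nhat m k v \<and>
     (if odd m then (v \<longlongrightarrow> 0) (at_right 0) else (vderiv v \<longlongrightarrow> 0) (at_right 0)) \<and>
     (\<exists>a b. has_endpoint_data (at_left \<xi>) v a b \<and> b - \<i> * k * of_real (n1_xi \<xi> nhat) * a = h)"

definition F2_solution ::
    "real \<Rightarrow> (real \<Rightarrow> real) \<Rightarrow> int \<Rightarrow> complex \<Rightarrow> complex \<Rightarrow> (real \<Rightarrow> complex) \<Rightarrow> bool" where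
  "F2_solution \<xi> nhat m k h v \<longleftrightarrow>
     radial_solution {\<xi><..<1} nhat m k v \<and>
     (\<exists>a b. has_endpoint_data (at_right \<xi>) v a b \<and> - b - \<i> * k * of_real (n2_xi \<xi> nhat) * a = h) \<and>
     (\<exists>a b. has_endpoint_data (at_left 1) v a b \<and> b - dtn_symbol m (k * of_real (n2_one nhat)) * a = 0)"

definition unique_solution_on ::
    "real set \<Rightarrow> ((real \<Rightarrow> complex) \<Rightarrow> bool) \<Rightarrow> (real \<Rightarrow> complex) \<Rightarrow> bool" where
  "unique_solution_on \<tau> P v \<longleftrightarrow> P v \<and> (\<forall>w. P w \<longrightarrow> (\<forall>r\<in>\<tau>. w r = v r))"

definition coupling_det ::
    "real \<Rightarrow> (complex \<Rightarrow> real \<Rightarrow> complex) \<Rightarrow> (complex \<Rightarrow> real \<Rightarrow> complex) \<Rightarrow> complex \<Rightarrow> complex" where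
  "coupling_det \<xi> f1 f2 k =
     - (Lim (at_left \<xi>) (f1 k) * Lim (at_right \<xi>) (vderiv (f2 k))
        - Lim (at_left \<xi>) (vderiv (f1 k)) * Lim (at_right \<xi>) (f2 k))"


section \<open>Newton iteration\<close>

definition newton_sequence :: "(complex \<Rightarrow> complex) \<Rightarrow> complex \<Rightarrow> (nat \<Rightarrow> complex) \<Rightarrow> bool" where
  "newton_sequence f z0 z \<longleftrightarrow> z 0 = z0 \<and> (\<forall>l. z (Suc l) = z l - f (z l) / deriv f (z l))"

definition converges_quadratically :: "(nat \<Rightarrow> complex) \<Rightarrow> complex \<Rightarrow> bool" where
  "converges_quadratically z w \<longleftrightarrow>
     z \<longlonglongrightarrow> w \<and> (\<exists>C. \<forall>l. dist (z (Suc l)) w \<le> C * (dist (z l) w)\<^sup>2)"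

end

theory Submission
  imports Defs
begin

text \<open>With \<open>M = |m|\<close>, \<open>w = r\<^sup>2\<^sup>M\<^sup>+\<^sup>1\<close>, \<open>u = r\<^sup>-\<^sup>M v\<close> and \<open>p = w u'\<close>, the radial equation becomes
  \<open>u' = p / w\<close>, \<open>p' = - k\<^sup>2 w n\<^sup>2 u\<close>. Its Picard iteration from the outer endpoint (\<open>0\<close> for (F1),
  \<open>1\<close> for (F2)) is a power series in \<open>k\<^sup>2\<close> with infinite radius of convergence, so a solution
  \<open>(U, P)\<close> satisfying the outer boundary condition has values at \<open>\<xi>\<close> that depend analytically
  on \<open>k\<close>. Any solution of (F1) or (F2) has vanishing Wronskian with \<open>(U, P)\<close>; together with the
  inhomogeneous condition at \<open>\<xi>\<close> this gives its value there as a quotient of analytic functions,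
  whose denominator is nonzero since the data \<open>h\<close> are. Hence \<open>det\<close> is analytic, and near a simple
  root \<open>det(z) = (z - k\<^sub>\<infinity>) q(z)\<close> gives
  \<open>z - det(z) / det'(z) - k\<^sub>\<infinity> = (z - k\<^sub>\<infinity>)\<^sup>2 q'(z) / det'(z)\<close>, which is the quadratic convergence.\<close>

section \<open>Newton's method at a simple zero\<close>

text \<open>The hypotheses give \<open>f1 k\<close> and \<open>f2 k\<close> for each
  \<open>k\<close> separately, with nothing linking neighbouring \<open>k\<close>, so analyticity
  has to come from solutions built independently of them. These start at the endpoint with the
  homogeneous condition, where the data do not involve \<open>h\<close>. For (F1) that endpoint is
  the singular point \<open>r = 0\<close>. Dividing by \<open>r^M\<close> takes out the exponent of
  the regular solution, whose data become \<open>U = 1\<close>, \<open>P = 0\<close>, and a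
  comparison \<open>w t \<le> C * w s\<close> for \<open>t \<le> s\<close> keeps the iteration
  regular where \<open>w\<close> vanishes. For (F2) the data at \<open>r = 1\<close> contain the
  Dirichlet-to-Neumann symbol, which depends on \<open>k\<close> through Hankel functions. Two
  families with fixed data are therefore combined with a coefficient that is analytic in
  \<open>k\<close>, away from the branch cut and the Hankel zeros. That the data \<open>h\<close>
  are nonzero excludes a vanishing denominator only if \<open>U\<close> and \<open>P\<close> do not
  vanish together at \<open>\<xi>\<close>; this is backward uniqueness from
  \<open>\<xi>\<close>.\<close>

lemma newton_step_quadratic:
  fixes f :: "complex \<Rightarrow> complex"
  assumes hol: "f holomorphic_on S" and S: "open S" "w \<in> S"
    and zero: "f w = 0" and simple: "deriv f w \<noteq> 0"
  obtains \<delta> C where "\<delta> > 0" "C \<ge> 0" "C * \<delta> \<le> 1 / 2" "ball w \<delta> \<subseteq> S"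
    "\<And>z. z \<in> ball w \<delta> \<Longrightarrow> deriv f z \<noteq> 0"
    "\<And>z. z \<in> ball w \<delta> \<Longrightarrow> dist (z - f z / deriv f z) w \<le> C * (dist z w)\<^sup>2"
proof -
  \<comment> \<open>The difference quotient with its removable singularity filled in.\<close>
  define q where "q = (\<lambda>z. if z = w then deriv f w else (f z - f w) / (z - w))"
  have q: "q holomorphic_on S"
    unfolding q_def by (rule pole_lemma_open[OF hol S(1)])
  have f_eq: "f z = (z - w) * q z" for z
    by (simp add: q_def zero)
  have f': "deriv f z = q z + (z - w) * deriv q z" if "z \<in> S" for z
  proof -
    have "(q has_field_derivative deriv q z) (at z)"
      using holomorphic_derivI[OF q S(1) that] .
    then have "((\<lambda>z. (z - w) * q z) has_field_derivative q z + (z - w) * deriv q z) (at z)"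
      by (auto intro!: derivative_eq_intros)
    then show ?thesis
      unfolding f_eq[abs_def] by (rule DERIV_imp_deriv)
  qed
  define g where "g = (\<lambda>z. deriv q z / deriv f z)"
  have cont': "continuous_on S (deriv f)" "continuous_on S (deriv q)"
    using hol q S(1) holomorphic_deriv holomorphic_on_imp_continuous_on by blast+
  have at_w: "isCont (deriv f) w" "isCont (deriv q) w"
    using cont' S continuous_on_eq_continuous_at by blast+
  have "isCont g w"
    unfolding g_def using at_w simple by (intro continuous_intros) auto
  then have ev1: "\<forall>\<^sub>F z in at w. dist (g z) (g w) < 1"
    unfolding isCont_def tendsto_iff by auto
  have ev2: "\<forall>\<^sub>F z in at w. deriv f z \<noteq> 0"
    using at_w(1) simple unfolding isCont_def by (rule tendsto_imp_eventually_ne)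
  have ev3: "\<forall>\<^sub>F z in at w. z \<in> S"
    using S by (simp add: eventually_at_in_open')
  obtain d where d: "d > 0"
    "\<And>z. z \<noteq> w \<Longrightarrow> dist z w < d \<Longrightarrow> dist (g z) (g w) < 1 \<and> deriv f z \<noteq> 0 \<and> z \<in> S"
    using eventually_conj[OF ev1 eventually_conj[OF ev2 ev3]] unfolding eventually_at by auto
  \<comment> \<open>The \<open>+ 1\<close> is the slack granted by \<open>ev1\<close>; the cap
    \<open>1 / (2 * C)\<close> in \<open>\<delta>\<close> later turns the quadratic bound into a
    halving of the distance, so that iterates stay in the ball.\<close>
  define C where "C = norm (g w) + 1"
  define \<delta> where "\<delta> = min d (1 / (2 * C))"
  have C: "C > 0" by (simp add: C_def add_nonneg_pos)
  show ?thesis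
  proof (rule that[of \<delta> C])
    show "\<delta> > 0" "C \<ge> 0" using d C by (auto simp: \<delta>_def)
    have "C * \<delta> \<le> C * (1 / (2 * C))" using C by (intro mult_left_mono) (auto simp: \<delta>_def)
    then show "C * \<delta> \<le> 1 / 2" using C by simp
    have near: "z \<in> S \<and> deriv f z \<noteq> 0 \<and> norm (g z) \<le> C" if "z \<in> ball w \<delta>" for z
    proof (cases "z = w")
      case False
      with d(2)[of z] that have *: "dist (g z) (g w) < 1 \<and> deriv f z \<noteq> 0 \<and> z \<in> S"
        by (auto simp: \<delta>_def dist_commute)
      moreover have "norm (g z) \<le> norm (g w) + dist (g z) (g w)"
        by (metis dist_norm norm_triangle_sub)
      ultimately show ?thesis by (auto simp: C_def)
    qed (use S simple in \<open>auto simp: C_def\<close>)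
    then show "ball w \<delta> \<subseteq> S" "\<And>z. z \<in> ball w \<delta> \<Longrightarrow> deriv f z \<noteq> 0" by auto
    fix z assume z: "z \<in> ball w \<delta>"
    note nz = near[OF z]
    have "z - f z / deriv f z - w = (z - w)\<^sup>2 * g z"
      using nz f'[of z] f_eq[of z] by (simp add: g_def field_simps power2_eq_square) algebra
    then have "dist (z - f z / deriv f z) w = norm (g z) * (dist z w)\<^sup>2"
      by (simp add: dist_norm norm_mult norm_power)
    then show "dist (z - f z / deriv f z) w \<le> C * (dist z w)\<^sup>2"
      using nz by (simp add: mult_right_mono)
  qed
qed

text \<open>As \<open>x / 0 = 0\<close> in HOL, \<open>newton_sequence\<close> is defined even where
  the derivative vanishes. The conclusion therefore also records that no iterate meets such a point
  or leaves \<open>S\<close>, so that every step is a genuine Newton step.\<close>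

lemma newton_local_quadratic_convergence:
  fixes f :: "complex \<Rightarrow> complex"
  assumes "f holomorphic_on S" "open S" "w \<in> S" "f w = 0" "deriv f w \<noteq> 0"
  shows "\<exists>\<delta>>0. \<forall>z0\<in>ball w \<delta>. \<forall>z. newton_sequence f z0 z \<longrightarrow>
    (\<forall>l. z l \<in> S \<and> deriv f (z l) \<noteq> 0) \<and> converges_quadratically z w"
proof -
  obtain \<delta> C where \<delta>: "\<delta> > 0" "C \<ge> 0" "C * \<delta> \<le> 1 / 2" "ball w \<delta> \<subseteq> S"
    "\<And>z. z \<in> ball w \<delta> \<Longrightarrow> deriv f z \<noteq> 0"
    "\<And>z. z \<in> ball w \<delta> \<Longrightarrow> dist (z - f z / deriv f z) w \<le> C * (dist z w)\<^sup>2"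
    using newton_step_quadratic[OF assms] by metis
  have "(\<forall>l. z l \<in> S \<and> deriv f (z l) \<noteq> 0) \<and> converges_quadratically z w"
    if z0: "z0 \<in> ball w \<delta>" and z: "newton_sequence f z0 z" for z0 z
  proof -
    have halve: "dist (z (Suc l)) w \<le> C * (dist (z l) w)\<^sup>2 \<and> dist (z (Suc l)) w \<le> dist (z l) w / 2"
      if "z l \<in> ball w \<delta>" for l
    proof -
      have "dist (z (Suc l)) w \<le> C * (dist (z l) w)\<^sup>2"
        using \<delta>(6)[OF that] z by (simp add: newton_sequence_def)
      moreover have "C * (dist (z l) w)\<^sup>2 \<le> C * (\<delta> * dist (z l) w)"
        unfolding power2_eq_square using that \<delta>(2)
        by (intro mult_left_mono mult_right_mono) (auto simp: dist_commute)
      moreover have "C * \<delta> * dist (z l) w \<le> 1 / 2 * dist (z l) w"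
        using \<delta>(3) by (rule mult_right_mono) simp
      ultimately show ?thesis by simp
    qed
    have ball: "z l \<in> ball w \<delta> \<and> dist (z l) w \<le> (1 / 2) ^ l * dist z0 w" for l
    proof (induction l)
      case 0
      then show ?case using z z0 by (simp add: newton_sequence_def)
    next
      case (Suc l)
      have "dist (z (Suc l)) w \<le> dist (z l) w / 2" using halve Suc by blast
      moreover have "dist (z l) w / 2 \<le> (1 / 2) ^ Suc l * dist z0 w" using Suc by simp
      moreover have "dist (z l) w / 2 < \<delta>"
        using Suc \<delta>(1) zero_le_dist[of "z l" w] by (simp add: dist_commute)
      ultimately show ?case by (simp add: dist_commute)
    qed
    have "(\<lambda>l. (1 / 2) ^ l * dist z0 w) \<longlonglongrightarrow> 0"
      by (intro tendsto_mult_left_zero LIMSEQ_realpow_zero) auto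
    then have "(\<lambda>l. dist (z l) w) \<longlonglongrightarrow> 0"
      by (rule tendsto_sandwich[rotated 3]) (use ball in auto)
    then have "z \<longlonglongrightarrow> w" using tendsto_dist_iff by blast
    then show ?thesis
      using ball \<delta>(4,5) halve unfolding converges_quadratically_def by blast
  qed
  then show ?thesis using \<delta>(1) by blast
qed

section \<open>Analyticity of the Dirichlet-to-Neumann symbol\<close>

text \<open>Serves both the Bessel series and, later, the values at \<open>L\<close> of the Picard
  series: a majorant that converges for every radius permits termwise differentiation on the whole
  plane.\<close>

lemma entire_of_norm_le:
  fixes c :: "nat \<Rightarrow> complex"
  assumes c: "\<And>j. norm (c j) \<le> a j" and a: "\<And>R. summable (\<lambda>j. a j * R ^ j)"
  shows "(\<lambda>z. \<Sum>j. c j * z ^ j) holomorphic_on S"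
proof -
  have "summable (\<lambda>j. c j * z ^ j)" for z
  proof (rule summable_comparison_test'[OF a[of "norm z"]])
    show "norm (c j * z ^ j) \<le> a j * norm z ^ j" for j
      using c[of j] by (simp add: norm_mult norm_power mult_right_mono)
  qed
  then have "((\<lambda>z. \<Sum>j. c j * z ^ j) has_field_derivative (\<Sum>j. diffs c j * z ^ j)) (at z)" for z
    by (rule termdiffs_strong_converges_everywhere)
  then show ?thesis
    unfolding holomorphic_on_def field_differentiable_def using has_field_derivative_at_within by blast
qed

lemma entire_of_norm_le_inverse_fact:
  fixes c :: "nat \<Rightarrow> complex"
  assumes "\<And>j. norm (c j) \<le> B / fact j"
  shows "(\<lambda>z. \<Sum>j. c j * z ^ j) holomorphic_on S"
proof (rule entire_of_norm_le[OF assms])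
  show "summable (\<lambda>j. B / fact j * R ^ j)" for R :: real
    using summable_mult[OF summable_exp[of R], of B] by (simp add: field_simps)
qed

lemma entire_compose:
  assumes "F holomorphic_on UNIV" "g holomorphic_on S"
  shows "(\<lambda>z. F (g z)) holomorphic_on S"
  using holomorphic_on_compose_gen[OF assms(2,1)] by (simp add: o_def)

text \<open>In the variable \<open>- (z^2 / 4)\<close> the coefficients are
  \<open>1 / (j! (n + j)!)\<close>; bounding the second factorial below by 1 leaves an exponential
  majorant.\<close>

lemma holomorphic_bessel_J [holomorphic_intros]:
  "bessel_J n holomorphic_on S"
proof -
  define F where "F = (\<lambda>w::complex. \<Sum>j. 1 / (fact j * fact (n + j)) * w ^ j)"
  have "F holomorphic_on UNIV"
    unfolding F_def
    by (rule entire_of_norm_le_inverse_fact[where B = 1])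
       (auto simp: norm_divide norm_mult field_simps)
  then have "(\<lambda>z. F (- (z\<^sup>2 / 4))) holomorphic_on S"
    by (rule entire_compose) (intro holomorphic_intros, simp)
  then have "(\<lambda>z. (z / 2) ^ n * F (- (z\<^sup>2 / 4))) holomorphic_on S"
    by (intro holomorphic_intros) auto
  then show ?thesis by (simp add: bessel_J_def[abs_def] F_def)
qed

text \<open>The value is a harmonic number minus Euler's constant, and each of the \<open>n\<close>
  summands as well as the constant is at most 1. Linear growth is slow enough for the factorials in
  the series of \<open>bessel_Y\<close>.\<close>

lemma norm_Digamma_Suc_le: "norm (Digamma (of_nat (Suc n)) :: complex) \<le> real n + 1"
proof -
  have "norm (harm n :: complex) \<le> real n"
  proof -
    have "norm (harm n :: complex) \<le> (\<Sum>k=1..n. 1)"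
      unfolding harm_def
      by (rule sum_norm_le) (auto simp: norm_inverse inverse_le_1_iff)
    then show ?thesis by simp
  qed
  moreover have "norm (euler_mascheroni :: complex) \<le> 1"
  proof -
    have "norm (of_real euler_mascheroni :: complex) \<le> 1"
      unfolding norm_of_real
      using euler_mascheroni_less_13_over_22 euler_mascheroni_gt_19_over_33 by linarith
    then show ?thesis by (simp only: of_real_euler_mascheroni)
  qed
  ultimately show ?thesis
    unfolding Digamma_of_nat using norm_triangle_ineq4[of "harm n :: complex" euler_mascheroni] by linarith
qed

text \<open>The factor \<open>(n + j)!\<close> absorbs the digamma terms and leaves the bound
  \<open>4 / j!\<close>, so the last series is entire. Off the nonpositive real axis the logarithm
  and the negative powers of \<open>z\<close> in the finite part are holomorphic too.\<close>

lemma holomorphic_bessel_Y: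
  assumes "\<And>z. z \<in> S \<Longrightarrow> z \<notin> \<real>\<^sub>\<le>\<^sub>0"
  shows "bessel_Y n holomorphic_on S"
proof -
  define d :: "nat \<Rightarrow> complex"
    where "d = (\<lambda>j. Digamma (of_nat (j + 1)) + Digamma (of_nat (n + j + 1)))"
  define F where "F = (\<lambda>w::complex. \<Sum>j. d j / (fact j * fact (n + j)) * w ^ j)"
  have "norm (d j / (fact j * fact (n + j))) \<le> 4 / fact j" for j
  proof -
    have fact_self: "real (n + j) \<le> fact (n + j)"
      by (metis fact_ge_self of_nat_fact of_nat_le_iff)
    have "norm (d j) \<le> (real j + 1) + (real (n + j) + 1)"
      unfolding d_def using norm_Digamma_Suc_le[of j] norm_Digamma_Suc_le[of "n + j"]
      by (intro norm_triangle_le) simp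
    also have "\<dots> \<le> 2 * real (n + j) + 2" by simp
    also have "\<dots> \<le> 4 * fact (n + j)"
      using add_mono[OF mult_left_mono[OF fact_self, of 2] mult_left_mono[OF fact_ge_1[of "n + j"], of 2]]
      by (simp del: fact_ge_1)
    finally have "norm (d j) \<le> 4 * fact (n + j)" .
    then show ?thesis by (simp add: norm_divide norm_mult field_simps)
  qed
  then have F: "F holomorphic_on UNIV"
    unfolding F_def by (rule entire_of_norm_le_inverse_fact)
  have "(\<lambda>z::complex. - (z\<^sup>2 / 4)) holomorphic_on S"
    by (intro holomorphic_intros) simp
  then have FS: "(\<lambda>z. F (- (z\<^sup>2 / 4))) holomorphic_on S"
    by (rule entire_compose[OF F])
  have half: "z / 2 \<notin> \<real>\<^sub>\<le>\<^sub>0" "z \<noteq> 0" if "z \<in> S" for z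
    using assms[OF that] by (auto simp: complex_nonpos_Reals_iff)
  have "(\<lambda>z. - inverse ((z / 2) ^ n) / of_real pi *
         (\<Sum>j<n. fact (n - j - 1) / fact j * (z\<^sup>2 / 4) ^ j)
     + 2 / of_real pi * ln (z / 2) * bessel_J n z
     - (z / 2) ^ n / of_real pi * F (- (z\<^sup>2 / 4))) holomorphic_on S"
    using half by (intro holomorphic_on_add holomorphic_on_diff holomorphic_on_mult FS holomorphic_intros) auto
  then show ?thesis by (simp add: bessel_Y_def[abs_def] F_def d_def)
qed

lemma holomorphic_hankel1:
  assumes "\<And>z. z \<in> S \<Longrightarrow> z \<notin> \<real>\<^sub>\<le>\<^sub>0"
  shows "hankel1 m holomorphic_on S"
proof -
  define c :: complex where "c = (if 0 \<le> m then 1 else (- 1) ^ nat \<bar>m\<bar>)"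
  have "bessel_Y (nat \<bar>m\<bar>) holomorphic_on S"
    using assms by (rule holomorphic_bessel_Y)
  then have "(\<lambda>z. c * (bessel_J (nat \<bar>m\<bar>) z + \<i> * bessel_Y (nat \<bar>m\<bar>) z)) holomorphic_on S"
    by (intro holomorphic_on_mult holomorphic_on_add holomorphic_on_const holomorphic_bessel_J)
  then show ?thesis
    by (simp only: hankel1_def[abs_def] c_def)
qed

lemma holomorphic_dtn_symbol:
  assumes "open S" "\<And>z. z \<in> S \<Longrightarrow> Im z < 0" "\<And>z. z \<in> S \<Longrightarrow> z \<notin> hankel1_zeros"
  shows "dtn_symbol m holomorphic_on S"
proof -
  have h: "hankel1 m holomorphic_on S"
    by (rule holomorphic_hankel1) (use assms(2) in \<open>fastforce simp: complex_nonpos_Reals_iff\<close>)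
  \<comment> \<open>\<open>hankel1_zeros\<close> leaves out the origin by definition, so
    \<open>z \<noteq> 0\<close> has to come from \<open>Im z < 0\<close>.\<close>
  moreover have "hankel1 m z \<noteq> 0" if "z \<in> S" for z
    using assms(2,3)[OF that] by (auto simp: hankel1_zeros_def)
  ultimately show ?thesis
    unfolding dtn_symbol_def[abs_def]
    by (intro holomorphic_on_mult holomorphic_on_divide holomorphic_on_ident
        holomorphic_deriv[OF h assms(1)])
qed

section \<open>Sturm--Liouville systems depending on a parameter\<close>

text \<open>The bounds \<open>M n\<close> make the series of derivatives converge uniformly on
  \<open>S\<close>, as \<open>has_derivative_series\<close> requires; since \<open>S\<close> is
  open, the derivative within \<open>S\<close> is the derivative at the point.\<close>

lemma has_vector_derivative_series:
  fixes f :: "nat \<Rightarrow> real \<Rightarrow> 'b::banach"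
  assumes S: "convex S" "open S"
    and der: "\<And>n x. x \<in> S \<Longrightarrow> (f n has_vector_derivative f' n x) (at x)"
    and M: "\<And>n x. x \<in> S \<Longrightarrow> norm (f' n x) \<le> M n" "summable M"
    and sums: "\<And>x. x \<in> S \<Longrightarrow> summable (\<lambda>n. f n x)"
    and x: "x \<in> S"
  shows "((\<lambda>x. \<Sum>n. f n x) has_vector_derivative (\<Sum>n. f' n x)) (at x)"
proof -
  have ul: "uniform_limit S (\<lambda>n x. \<Sum>i<n. f' i x) (\<lambda>x. \<Sum>i. f' i x) sequentially"
    by (rule Weierstrass_m_test[OF M])
  have "\<exists>g. \<forall>x\<in>S. (\<lambda>n. f n x) sums g x \<and>
      (g has_derivative (\<lambda>h. h *\<^sub>R (\<Sum>i. f' i x))) (at x within S)"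
  proof (rule has_derivative_series[OF S(1), where f' = "\<lambda>n x h. h *\<^sub>R f' n x"])
    show "(f n has_derivative (\<lambda>h. h *\<^sub>R f' n y)) (at y within S)" if "y \<in> S" for n y
      using der[OF that] unfolding has_vector_derivative_def by (rule has_derivative_at_withinI)
    show "\<forall>\<^sub>F n in sequentially. \<forall>x\<in>S. \<forall>h.
        norm ((\<Sum>i<n. h *\<^sub>R f' i x) - h *\<^sub>R (\<Sum>i. f' i x)) \<le> e * norm h" if "e > 0" for e
      using uniform_limitD[OF ul that]
    proof eventually_elim
      case (elim n)
      show ?case
      proof (intro ballI allI)
        fix y h assume "y \<in> S"
        then have "norm ((\<Sum>i<n. f' i y) - (\<Sum>i. f' i y)) \<le> e"
          using elim by (auto simp: dist_norm less_imp_le)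
        then show "norm ((\<Sum>i<n. h *\<^sub>R f' i y) - h *\<^sub>R (\<Sum>i. f' i y)) \<le> e * norm h"
          using mult_left_mono[of _ e "\<bar>h\<bar>"]
          by (simp flip: scaleR_sum_right scaleR_diff_right add: mult.commute[of e])
      qed
    qed
    show "x \<in> S" "(\<lambda>n. f n x) sums suminf (\<lambda>n. f n x)"
      using x sums summable_sums by blast+
  qed
  then obtain g where g: "\<And>y. y \<in> S \<Longrightarrow> (\<lambda>n. f n y) sums g y"
    "(g has_derivative (\<lambda>h. h *\<^sub>R (\<Sum>i. f' i x))) (at x within S)"
    using x by blast
  have "((\<lambda>x. \<Sum>n. f n x) has_derivative (\<lambda>h. h *\<^sub>R (\<Sum>i. f' i x))) (at x)"
    using g(2) unfolding at_within_open[OF x S(2)]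
    by (rule has_derivative_transform_within_open[OF _ S(2) x]) (use g(1) sums_unique in blast)
  then show ?thesis by (simp add: has_vector_derivative_def)
qed

lemma continuous_on_Icc_abs_le:
  fixes g :: "real \<Rightarrow> real"
  assumes "continuous_on {a..b} g"
  shows "\<exists>B. \<forall>t\<in>{a..b}. \<bar>g t\<bar> \<le> B"
proof -
  have "bounded (g ` {a..b})"
    by (intro compact_imp_bounded compact_continuous_image assms compact_Icc)
  then show ?thesis by (auto simp: bounded_iff)
qed

text \<open>First-order form of \<open>(w u')' = - \<mu> w N u\<close> with the flux \<open>p = w u'\<close>; the weight \<open>w\<close> may vanish at \<open>0\<close>.\<close>

definition sl_solution ::
    "real \<Rightarrow> (real \<Rightarrow> real) \<Rightarrow> (real \<Rightarrow> real) \<Rightarrow> complex \<Rightarrow>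
      (real \<Rightarrow> complex) \<Rightarrow> (real \<Rightarrow> complex) \<Rightarrow> bool" where
  "sl_solution L w N \<mu> u p \<longleftrightarrow> (\<forall>x\<in>{0<..<L}.
     (u has_vector_derivative p x / of_real (w x)) (at x) \<and>
     (p has_vector_derivative - \<mu> * of_real (w x * N x) * u x) (at x))"

text \<open>\<open>w_le\<close> is monotonicity of the weight up to a factor. It bounds the kernel
  \<open>w t / w s\<close>, \<open>t \<le> s\<close>, of the Picard iteration although
  \<open>w 0 = 0\<close> is allowed. (F1) has an increasing weight and \<open>C = 1\<close>; the
  reflected weight of (F2) decreases but stays away from 0, which gives a larger
  \<open>C\<close>.\<close>

locale sturm_liouville =
  fixes L C :: real and w N :: "real \<Rightarrow> real"
  assumes L_pos: "0 < L"
    and w_cont: "continuous_on {0..L} w" and N_cont: "continuous_on {0..L} N"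
    and w_pos: "\<And>x. 0 < x \<Longrightarrow> x \<le> L \<Longrightarrow> 0 < w x" and w_0: "0 \<le> w 0"
    and w_le: "\<And>s t. 0 \<le> t \<Longrightarrow> t \<le> s \<Longrightarrow> s \<le> L \<Longrightarrow> w t \<le> C * w s"
begin

lemma w_nonneg: "0 \<le> x \<Longrightarrow> x \<le> L \<Longrightarrow> 0 \<le> w x"
  using w_pos[of x] w_0 by (cases "x = 0") auto

section \<open>Picard coefficients of the series in the spectral parameter\<close>

definition flux_of :: "(real \<Rightarrow> real) \<Rightarrow> real \<Rightarrow> real" where
  "flux_of g s = - integral {0..s} (\<lambda>t. w t * N t * g t)"

text \<open>These are the coefficients of \<open>\<mu> ^ j\<close>, not the successive
  approximations; with \<open>\<mu>\<close> split off they are real and independent of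
  \<open>k\<close>. At \<open>s = 0\<close> the integrand has the value 0, also its limit, because
  \<open>flux_of\<close> vanishes there.\<close>

primrec picard :: "(real \<Rightarrow> real) \<Rightarrow> nat \<Rightarrow> real \<Rightarrow> real" where
  "picard U0 0 = U0"
| "picard U0 (Suc j) = (\<lambda>x. integral {0..x} (\<lambda>s. flux_of (picard U0 j) s / w s))"

definition N_max :: real where
  "N_max = (SUP x\<in>{0..L}. \<bar>N x\<bar>)"

lemma N_le:
  assumes "0 \<le> x" "x \<le> L"
  shows "\<bar>N x\<bar> \<le> N_max"
proof -
  obtain B where "\<And>t. t \<in> {0..L} \<Longrightarrow> \<bar>N t\<bar> \<le> B"
    using continuous_on_Icc_abs_le[OF N_cont] by blast
  then have "bdd_above ((\<lambda>x. \<bar>N x\<bar>) ` {0..L})"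
    by (intro bdd_aboveI2)
  then show ?thesis
    unfolding N_max_def by (rule cSUP_upper[rotated]) (use assms in simp)
qed

lemma N_max_nonneg: "0 \<le> N_max"
  using N_le[of 0] L_pos by auto

lemma C_pos: "0 < C"
proof (rule ccontr)
  assume "\<not> 0 < C"
  then have "C * w L \<le> 0" using w_nonneg[of L] L_pos by (simp add: mult_nonpos_nonneg)
  moreover have "w L \<le> C * w L" using w_le[of L L] L_pos by simp
  ultimately show False using w_pos[of L] L_pos by linarith
qed

text \<open>\<open>w_le\<close> pulls the weight out of the integral at the upper limit
  \<open>s\<close>, so the subsequent division by \<open>w s\<close> costs nothing even where
  \<open>w s\<close> is small.\<close>

lemma flux_of_le:
  assumes g: "continuous_on {0..L} g" "\<And>t. 0 \<le> t \<Longrightarrow> t \<le> s \<Longrightarrow> \<bar>g t\<bar> \<le> b"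
    and s: "0 \<le> s" "s \<le> L"
  shows "\<bar>flux_of g s\<bar> \<le> w s * (C * N_max * b * s)"
proof -
  have "norm (integral {0..s} (\<lambda>t. w t * N t * g t)) \<le> (C * w s * N_max * b) * (s - 0)"
  proof (rule integral_bound[OF s(1)])
    have "continuous_on {0..L} (\<lambda>t. w t * N t * g t)"
      by (intro continuous_intros w_cont N_cont g)
    then show "continuous_on {0..s} (\<lambda>t. w t * N t * g t)"
      by (rule continuous_on_subset) (use s in auto)
    fix t assume t: "t \<in> {0..s}"
    have "\<bar>w t\<bar> * \<bar>N t\<bar> * \<bar>g t\<bar> \<le> (C * w s) * N_max * b"
    proof (intro mult_mono)
      show "\<bar>w t\<bar> \<le> C * w s" using t s w_le w_nonneg by auto
      show "\<bar>N t\<bar> \<le> N_max" using t s N_le by auto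
    qed (use t s g C_pos w_nonneg N_max_nonneg in auto)
    then show "norm (w t * N t * g t) \<le> C * w s * N_max * b" by (simp add: abs_mult)
  qed
  then show ?thesis by (simp add: flux_of_def mult_ac)
qed

lemma flux_of_derivative:
  assumes g: "continuous_on {0..L} g" and s: "s \<in> {0..L}"
  shows "(flux_of g has_real_derivative - (w s * N s * g s)) (at s within {0..L})"
proof -
  have "continuous_on {0..L} (\<lambda>t. w t * N t * g t)"
    by (intro continuous_intros w_cont N_cont g)
  from DERIV_minus[OF integral_has_real_derivative[OF this s]]
  show ?thesis by (simp add: flux_of_def[abs_def])
qed

lemma flux_of_continuous:
  "continuous_on {0..L} g \<Longrightarrow> continuous_on {0..L} (flux_of g)"
  by (rule DERIV_continuous_on[OF flux_of_derivative])

text \<open>Only \<open>s = 0\<close> is delicate, as \<open>w\<close> may vanish there; by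
  \<open>flux_of_le\<close> the ratio is \<open>O(s)\<close>.\<close>

lemma flux_of_ratio_continuous:
  assumes g: "continuous_on {0..L} g"
  shows "continuous_on {0..L} (\<lambda>s. flux_of g s / w s)"
  unfolding continuous_on_eq_continuous_within
proof
  fix s assume s: "s \<in> {0..L}"
  show "continuous (at s within {0..L}) (\<lambda>s. flux_of g s / w s)"
  proof (cases "s = 0")
    case False
    have "continuous (at s within {0..L}) (flux_of g)" "continuous (at s within {0..L}) w"
      using flux_of_continuous[OF g] w_cont s by (auto simp: continuous_on_eq_continuous_within)
    moreover have "w s \<noteq> 0" using w_pos[of s] s False by auto
    ultimately show ?thesis by (rule continuous_at_within_divide)
  next
    case True
    obtain b where b: "\<And>t. t \<in> {0..L} \<Longrightarrow> \<bar>g t\<bar> \<le> b"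
      using continuous_on_Icc_abs_le[OF g] by blast
    have "((\<lambda>s. flux_of g s / w s) \<longlongrightarrow> 0) (at 0 within {0..L})"
    proof (rule Lim_null_comparison)
      have "norm (flux_of g s / w s) \<le> C * N_max * b * s" if "s \<in> {0..L}" "s \<noteq> 0" for s
      proof -
        have "\<bar>flux_of g s\<bar> \<le> w s * (C * N_max * b * s)"
          by (rule flux_of_le[OF g]) (use b that in auto)
        then show ?thesis using w_pos[of s] that by (simp add: field_simps)
      qed
      then show "\<forall>\<^sub>F s in at 0 within {0..L}. norm (flux_of g s / w s) \<le> C * N_max * b * s"
        by (simp add: eventually_at_filter)
      have "((\<lambda>s. C * N_max * b * s) \<longlongrightarrow> C * N_max * b * 0) (at 0 within {0..L})"
        by (intro tendsto_intros)
      then show "((\<lambda>s. C * N_max * b * s) \<longlongrightarrow> 0) (at 0 within {0..L})" by simp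
    qed
    then show ?thesis by (simp add: True continuous_within flux_of_def)
  qed
qed

lemma picard_continuous:
  assumes "continuous_on {0..L} U0"
  shows "continuous_on {0..L} (picard U0 j)"
proof (induction j)
  case (Suc j)
  then show ?case
    by (simp add: indefinite_integral_continuous_1 integrable_continuous_real flux_of_ratio_continuous)
qed (use assms in simp)

text \<open>The factorial comes from integrating \<open>s ^ j\<close> in the outer integral. The
  extra factor \<open>s\<close> supplied by \<open>flux_of_le\<close> is simply bounded by
  \<open>L\<close>, which is how \<open>L\<close> enters the constant.\<close>

lemma picard_le:
  assumes U0: "continuous_on {0..L} U0" "\<And>x. x \<in> {0..L} \<Longrightarrow> \<bar>U0 x\<bar> \<le> B"
    and x: "0 \<le> x" "x \<le> L"
  shows "\<bar>picard U0 j x\<bar> \<le> B * (C * N_max * L) ^ j / fact j * x ^ j"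
  using x
proof (induction j arbitrary: x)
  case 0
  then show ?case using U0(2) by simp
next
  case (Suc j)
  define K where "K = C * N_max * L"
  define b where "b = B * K ^ j / fact j"
  have B: "0 \<le> B" using U0(2)[of 0] L_pos by auto
  have K: "0 \<le> K" using C_pos N_max_nonneg L_pos by (simp add: K_def)
  have b: "0 \<le> b" using B K by (simp add: b_def)
  have cont: "continuous_on {0..L} (\<lambda>s. flux_of (picard U0 j) s / w s)"
    by (intro flux_of_ratio_continuous picard_continuous U0)
  have bound: "\<bar>flux_of (picard U0 j) s / w s\<bar> \<le> K * b * s ^ j" if s: "0 \<le> s" "s \<le> L" for s
  proof (cases "s = 0")
    case False
    have "\<bar>flux_of (picard U0 j) s\<bar> \<le> w s * (C * N_max * (b * s ^ j) * s)"
    proof (rule flux_of_le[OF picard_continuous[OF U0(1)] _ s])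
      fix t assume t: "0 \<le> t" "t \<le> s"
      have "\<bar>picard U0 j t\<bar> \<le> b * t ^ j" using Suc.IH[of t] t s by (simp add: b_def K_def)
      also have "\<dots> \<le> b * s ^ j" using t b by (intro mult_left_mono power_mono)
      finally show "\<bar>picard U0 j t\<bar> \<le> b * s ^ j" .
    qed
    then have "\<bar>flux_of (picard U0 j) s / w s\<bar> \<le> C * N_max * (b * s ^ j) * s"
      using w_pos[of s] s False by (simp add: abs_of_pos field_simps)
    also have "\<dots> \<le> C * N_max * (b * s ^ j) * L"
      using s b C_pos N_max_nonneg by (intro mult_left_mono) auto
    finally show ?thesis by (simp add: K_def mult_ac)
  qed (use K b in \<open>simp add: flux_of_def\<close>)
  have pow: "((\<lambda>s. K * b * s ^ j) has_integral
      K * b * x ^ Suc j / real (Suc j) - K * b * 0 ^ Suc j / real (Suc j)) {0..x}"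
    using Suc.prems(1)
    by (rule fundamental_theorem_of_calculus)
       (auto intro!: derivative_eq_intros simp flip: has_real_derivative_iff_has_vector_derivative
         simp del: of_nat_Suc power_Suc)
  have "norm (integral {0..x} (\<lambda>s. flux_of (picard U0 j) s / w s)) \<le> integral {0..x} (\<lambda>s. K * b * s ^ j)"
  proof (rule integral_norm_bound_integral)
    show "(\<lambda>s. flux_of (picard U0 j) s / w s) integrable_on {0..x}"
      using Suc.prems by (intro integrable_continuous_real continuous_on_subset[OF cont]) auto
    show "(\<lambda>s. K * b * s ^ j) integrable_on {0..x}" using pow by blast
    show "norm (flux_of (picard U0 j) s / w s) \<le> K * b * s ^ j" if "s \<in> {0..x}" for s
      using bound[of s] that Suc.prems(2) by simp
  qed
  also have "integral {0..x} (\<lambda>s. K * b * s ^ j) = K * b * x ^ Suc j / real (Suc j)"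
    using integral_unique[OF pow] by simp
  also have "\<dots> = B * K ^ Suc j / fact (Suc j) * x ^ Suc j"
    by (simp add: b_def field_simps)
  finally show ?case by (simp add: K_def)
qed

text \<open>\<open>(U0, P0)\<close> is a solution for \<open>\<mu> = 0\<close>, and the series in
  \<open>\<mu>\<close> corrects it. The condition on \<open>P0\<close> admits zero flux for a weight
  that vanishes at 0 and nonzero flux for a weight bounded below. The bound of \<open>P\<close> by
  \<open>w\<close> is exported for the Wronskian at the singular end.\<close>

lemma solution_family:
  assumes U0: "continuous_on {0..L} U0"
    and U0': "\<And>x. x \<in> {0<..<L} \<Longrightarrow> (U0 has_real_derivative P0 / w x) (at x)"
    and P0: "\<And>x. x \<in> {0..L} \<Longrightarrow> \<bar>P0\<bar> \<le> A * w x" and A: "0 \<le> A"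
  obtains U P :: "complex \<Rightarrow> real \<Rightarrow> complex" where
    "\<And>\<mu>. sl_solution L w N \<mu> (U \<mu>) (P \<mu>)"
    "\<And>\<mu>. continuous_on {0..L} (U \<mu>)" "\<And>\<mu>. continuous_on {0..L} (P \<mu>)"
    "\<And>\<mu>. U \<mu> 0 = of_real (U0 0)" "\<And>\<mu>. P \<mu> 0 = of_real P0"
    "\<And>\<mu>. \<exists>K. \<forall>x\<in>{0..L}. norm (P \<mu> x) \<le> K * w x"
    "(\<lambda>\<mu>. U \<mu> L) holomorphic_on UNIV" "(\<lambda>\<mu>. P \<mu> L) holomorphic_on UNIV"
proof -
  obtain B where B: "\<And>t. t \<in> {0..L} \<Longrightarrow> \<bar>U0 t\<bar> \<le> B"
    using continuous_on_Icc_abs_le[OF U0] by blast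
  obtain W where W: "\<And>t. t \<in> {0..L} \<Longrightarrow> \<bar>w t\<bar> \<le> W"
    using continuous_on_Icc_abs_le[OF w_cont] by blast
  define K where "K = C * N_max * L"
  define M where "M = (\<lambda>j. B * (K * L) ^ j / fact j)"
  \<comment> \<open>\<open>G j\<close> bounds \<open>p j / w\<close> and \<open>H j\<close> bounds
    the derivative \<open>dp j\<close> of \<open>p j\<close>. All three sequences shift by one
    because the flux of order \<open>Suc i\<close> is built from \<open>u i\<close>.\<close>
  define G where "G = (\<lambda>j. case j of 0 \<Rightarrow> A | Suc i \<Rightarrow> K * M i)"
  define H where "H = (\<lambda>j. case j of 0 \<Rightarrow> 0 | Suc i \<Rightarrow> W * N_max * M i)"
  define u where "u = picard U0"
  define p where "p = (\<lambda>j. case j of 0 \<Rightarrow> (\<lambda>x. P0) | Suc i \<Rightarrow> flux_of (u i))"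
  define dp where "dp = (\<lambda>j. case j of 0 \<Rightarrow> (\<lambda>x. 0) | Suc i \<Rightarrow> (\<lambda>x. - (w x * N x * u i x)))"
  have B0: "0 \<le> B" using B[of 0] L_pos by auto
  have W0: "0 \<le> W" using W[of 0] L_pos by auto
  have K0: "0 \<le> K" using C_pos N_max_nonneg L_pos by (simp add: K_def)
  have u_cont: "continuous_on {0..L} (u j)" for j
    unfolding u_def by (rule picard_continuous[OF U0])
  have p_cont: "continuous_on {0..L} (p j)" for j
    by (cases j) (auto simp: p_def intro!: flux_of_continuous u_cont)
  have M0: "0 \<le> M j" for j using B0 K0 L_pos by (simp add: M_def)
  have u_le: "\<bar>u j x\<bar> \<le> M j" if "x \<in> {0..L}" for j x
  proof -
    have "\<bar>u j x\<bar> \<le> B * K ^ j / fact j * x ^ j"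
      using picard_le[OF U0 B, of x j] that by (simp add: u_def K_def)
    also have "\<dots> \<le> B * K ^ j / fact j * L ^ j"
      using that B0 K0 by (intro mult_left_mono power_mono) auto
    finally show ?thesis by (simp add: M_def power_mult_distrib)
  qed
  have p_le: "\<bar>p j x\<bar> \<le> w x * G j" if "x \<in> {0..L}" for j x
  proof (cases j)
    case 0
    then show ?thesis using P0[OF that] by (simp add: p_def G_def mult.commute)
  next
    case (Suc i)
    have "\<bar>flux_of (u i) x\<bar> \<le> w x * (C * N_max * M i * x)"
      by (rule flux_of_le[OF u_cont]) (use that u_le in auto)
    also have "\<dots> \<le> w x * (C * N_max * M i * L)"
      using that C_pos N_max_nonneg M0 w_nonneg by (intro mult_left_mono) auto
    finally show ?thesis by (simp add: Suc p_def G_def K_def mult_ac)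
  qed
  have dp_le: "\<bar>dp j x\<bar> \<le> H j" if "x \<in> {0..L}" for j x
  proof (cases j)
    case (Suc i)
    have "\<bar>w x\<bar> * \<bar>N x\<bar> * \<bar>u i x\<bar> \<le> W * N_max * M i"
      using W[OF that] N_le[of x] u_le[OF that] that W0 N_max_nonneg by (intro mult_mono) auto
    then show ?thesis by (simp add: Suc dp_def H_def abs_mult)
  qed (simp add: dp_def H_def)
  have u_der: "(u j has_real_derivative p j x / w x) (at x)" if x: "x \<in> {0<..<L}" for j x
  proof (cases j)
    case 0
    then show ?thesis using U0'[OF x] by (simp add: u_def p_def)
  next
    case (Suc i)
    have "(picard U0 (Suc i) has_real_derivative flux_of (u i) x / w x) (at x within {0..L})"
      using integral_has_real_derivative[OF flux_of_ratio_continuous[OF u_cont]] x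
      by (auto simp: u_def)
    then show ?thesis
      using x at_within_interior[of x "{0..L}"] by (simp add: Suc u_def p_def)
  qed
  have p_der: "(p j has_real_derivative dp j x) (at x)" if x: "x \<in> {0<..<L}" for j x
  proof (cases j)
    case (Suc i)
    have "(flux_of (u i) has_real_derivative - (w x * N x * u i x)) (at x within {0..L})"
      using flux_of_derivative[OF u_cont] x by auto
    then show ?thesis
      using x at_within_interior[of x "{0..L}"] by (simp add: Suc p_def dp_def)
  qed (simp add: p_def dp_def)
  have M_sum: "summable (\<lambda>j. M j * R ^ j)" for R
    using summable_mult[OF summable_exp[of "K * L * R"], of B]
    by (simp add: M_def field_simps power_mult_distrib)
  have G_sum: "summable (\<lambda>j. G j * R ^ j)" for R
    unfolding summable_Suc_iff[of "\<lambda>j. G j * R ^ j", symmetric]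
    using summable_mult[OF M_sum[of R], of "K * R"] by (simp add: G_def mult_ac)
  have H_sum: "summable (\<lambda>j. H j * R ^ j)" for R
    unfolding summable_Suc_iff[of "\<lambda>j. H j * R ^ j", symmetric]
    using summable_mult[OF M_sum[of R], of "W * N_max * R"] by (simp add: H_def mult_ac)
  define U where "U = (\<lambda>\<mu> x. \<Sum>j. complex_of_real (u j x) * \<mu> ^ j)"
  define P where "P = (\<lambda>\<mu> x. \<Sum>j. complex_of_real (p j x) * \<mu> ^ j)"
  have cont_series: "continuous_on {0..L} (\<lambda>x. \<Sum>j. complex_of_real (f j x) * \<mu> ^ j)"
    if f: "\<And>j. continuous_on {0..L} (f j)" "\<And>j x. x \<in> {0..L} \<Longrightarrow> \<bar>f j x\<bar> \<le> a j"
      "summable (\<lambda>j. a j * norm \<mu> ^ j)" for f a \<mu>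
  proof (rule uniform_limit_theorem)
    show "uniform_limit {0..L} (\<lambda>n x. \<Sum>j<n. complex_of_real (f j x) * \<mu> ^ j)
        (\<lambda>x. \<Sum>j. complex_of_real (f j x) * \<mu> ^ j) sequentially"
      using f(2,3) by (intro Weierstrass_m_test) (auto simp: norm_mult norm_power mult_right_mono)
    show "\<forall>\<^sub>F n in sequentially. continuous_on {0..L} (\<lambda>x. \<Sum>j<n. complex_of_real (f j x) * \<mu> ^ j)"
      using f(1) by (intro always_eventually allI continuous_intros)
  qed auto
  have norm_u: "norm (complex_of_real (u j x) * \<mu> ^ j) \<le> M j * norm \<mu> ^ j" if "x \<in> {0..L}" for j x \<mu>
    using u_le[OF that] by (simp add: norm_mult norm_power mult_right_mono)
  have norm_p: "norm (complex_of_real (p j x) * \<mu> ^ j) \<le> w x * (G j * norm \<mu> ^ j)" if "x \<in> {0..L}" for j x \<mu>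
    using p_le[OF that, of j] mult_right_mono[OF p_le[OF that, of j], of "norm \<mu> ^ j"]
    by (simp add: norm_mult norm_power)
  have u_summable: "summable (\<lambda>j. complex_of_real (u j x) * \<mu> ^ j)" if "x \<in> {0..L}" for x \<mu>
    by (rule summable_comparison_test'[OF M_sum norm_u[OF that]])
  have p_summable: "summable (\<lambda>j. complex_of_real (p j x) * \<mu> ^ j)" if "x \<in> {0..L}" for x \<mu>
    by (rule summable_comparison_test'[OF summable_mult[OF G_sum] norm_p[OF that]])
  show ?thesis
  proof (rule that[of U P])
    fix \<mu>
    show "continuous_on {0..L} (U \<mu>)"
      unfolding U_def by (rule cont_series[OF u_cont u_le M_sum])
    have p_le': "\<bar>p j x\<bar> \<le> W * G j" if "x \<in> {0..L}" for j x
      using p_le[OF that, of j] W[OF that] A K0 M0[of "j - 1"]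
      by (intro order_trans[OF p_le[OF that, of j]] mult_right_mono) (auto simp: G_def split: nat.split)
    show "continuous_on {0..L} (P \<mu>)"
      unfolding P_def
      by (rule cont_series[OF p_cont p_le']) (use summable_mult[OF G_sum, of W] in \<open>simp_all add: mult_ac\<close>)
    have "u (Suc j) 0 = 0" "p (Suc j) 0 = 0" for j by (simp_all add: u_def p_def flux_of_def)
    then show "U \<mu> 0 = of_real (U0 0)" "P \<mu> 0 = of_real P0"
      using suminf_split_head[OF u_summable[of 0 \<mu>]] suminf_split_head[OF p_summable[of 0 \<mu>]] L_pos
      by (simp_all add: U_def P_def) (simp_all add: u_def p_def)
    show "\<exists>K. \<forall>x\<in>{0..L}. norm (P \<mu> x) \<le> K * w x"
    proof (intro exI ballI)
      fix x assume x: "x \<in> {0..L}"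
      have "norm (P \<mu> x) \<le> (\<Sum>j. w x * (G j * norm \<mu> ^ j))"
        unfolding P_def by (rule norm_suminf_le[OF norm_p[OF x] summable_mult[OF G_sum]])
      also have "\<dots> = (\<Sum>j. G j * norm \<mu> ^ j) * w x"
        by (simp add: suminf_mult[OF G_sum] mult.commute)
      finally show "norm (P \<mu> x) \<le> (\<Sum>j. G j * norm \<mu> ^ j) * w x" .
    qed
    show "sl_solution L w N \<mu> (U \<mu>) (P \<mu>)"
      unfolding sl_solution_def
    proof (intro ballI conjI)
      fix x assume x: "x \<in> {0<..<L}"
      have in_cl: "y \<in> {0<..<L} \<Longrightarrow> y \<in> {0..L}" for y by auto
      have w_x: "0 < w y" if "y \<in> {0<..<L}" for y using w_pos[of y] that by auto
      have "(U \<mu> has_vector_derivative (\<Sum>j. complex_of_real (p j x / w x) * \<mu> ^ j)) (at x)"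
        unfolding U_def
      proof (rule has_vector_derivative_series[where S = "{0<..<L}" and M = "\<lambda>j. G j * norm \<mu> ^ j"])
        show "((\<lambda>x. complex_of_real (u j x) * \<mu> ^ j) has_vector_derivative
            complex_of_real (p j y / w y) * \<mu> ^ j) (at y)" if "y \<in> {0<..<L}" for j y
          using u_der[OF that] by (intro has_vector_derivative_mult_left has_vector_derivative_of_real)
            (simp add: has_real_derivative_iff_has_vector_derivative)
        show "norm (complex_of_real (p j y / w y) * \<mu> ^ j) \<le> G j * norm \<mu> ^ j"
          if "y \<in> {0<..<L}" for j y
        proof -
          have "norm (complex_of_real (p j y / w y)) \<le> G j"
            using p_le[OF in_cl[OF that], of j] w_x[OF that] by (simp add: norm_divide field_simps)
          then show ?thesis
            unfolding norm_mult norm_power by (rule mult_right_mono) simp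
        qed
      qed (use x u_summable in_cl G_sum in auto)
      also have "(\<Sum>j. complex_of_real (p j x / w x) * \<mu> ^ j) = P \<mu> x / of_real (w x)"
        using suminf_divide[OF p_summable[OF in_cl[OF x]], of \<mu> "of_real (w x)"] by (simp add: P_def)
      finally show "(U \<mu> has_vector_derivative P \<mu> x / of_real (w x)) (at x)" .
      have "(P \<mu> has_vector_derivative (\<Sum>j. complex_of_real (dp j x) * \<mu> ^ j)) (at x)"
        unfolding P_def
      proof (rule has_vector_derivative_series[where S = "{0<..<L}" and M = "\<lambda>j. H j * norm \<mu> ^ j"])
        show "((\<lambda>x. complex_of_real (p j x) * \<mu> ^ j) has_vector_derivative
            complex_of_real (dp j y) * \<mu> ^ j) (at y)" if "y \<in> {0<..<L}" for j y
          using p_der[OF that] by (intro has_vector_derivative_mult_left has_vector_derivative_of_real)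
            (simp add: has_real_derivative_iff_has_vector_derivative)
        show "norm (complex_of_real (dp j y) * \<mu> ^ j) \<le> H j * norm \<mu> ^ j"
          if "y \<in> {0<..<L}" for j y
          using dp_le[OF in_cl[OF that], of j]
          by (simp add: norm_mult norm_power mult_right_mono)
      qed (use x p_summable in_cl H_sum in auto)
      \<comment> \<open>Index shift: \<open>dp (Suc j)\<close> is \<open>- w * N * u j\<close>, so
        one power of \<open>\<mu>\<close> moves in front, and \<open>dp 0 = 0\<close> because
        \<open>p 0\<close> is constant.\<close>
      also have "(\<Sum>j. complex_of_real (dp j x) * \<mu> ^ j) = - \<mu> * of_real (w x * N x) * U \<mu> x"
      proof -
        have "(\<lambda>j. (- \<mu> * of_real (w x * N x)) * (complex_of_real (u j x) * \<mu> ^ j)) sums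
            ((- \<mu> * of_real (w x * N x)) * U \<mu> x)"
          unfolding U_def by (intro sums_mult summable_sums u_summable in_cl x)
        then have "(\<lambda>j. complex_of_real (dp (Suc j) x) * \<mu> ^ Suc j) sums
            (- \<mu> * of_real (w x * N x) * U \<mu> x)"
          by (simp add: dp_def mult_ac)
        then have "(\<lambda>j. complex_of_real (dp j x) * \<mu> ^ j) sums
            (- \<mu> * of_real (w x * N x) * U \<mu> x + complex_of_real (dp 0 x) * \<mu> ^ 0)"
          by (subst (asm) sums_Suc_iff) simp
        then show ?thesis by (simp add: dp_def sums_iff)
      qed
      finally show "(P \<mu> has_vector_derivative - \<mu> * of_real (w x * N x) * U \<mu> x) (at x)" .
    qed
  next
    have L: "L \<in> {0..L}" using L_pos by simp
    show "(\<lambda>\<mu>. U \<mu> L) holomorphic_on UNIV"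
      unfolding U_def by (rule entire_of_norm_le[OF _ M_sum]) (use u_le[OF L] in simp)
    show "(\<lambda>\<mu>. P \<mu> L) holomorphic_on UNIV"
      unfolding P_def
    proof (rule entire_of_norm_le)
      show "norm (complex_of_real (p j L)) \<le> w L * G j" for j using p_le[OF L] by simp
      show "summable (\<lambda>j. w L * G j * R ^ j)" for R
        using summable_mult[OF G_sum[of R], of "w L"] by (simp add: mult_ac)
    qed
  qed
qed

end

section \<open>Wronskians and values at the far end\<close>

text \<open>Both solutions share \<open>\<mu>\<close>, so in the derivative the two terms with
  \<open>1 / w\<close> cancel and so do the two with \<open>w * N\<close>.\<close>

lemma sl_wronskian_constant:
  assumes "sl_solution L w N \<mu> u p" "sl_solution L w N \<mu> U P"
  obtains c where "\<And>x. x \<in> {0<..<L} \<Longrightarrow> u x * P x - p x * U x = c"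
proof -
  define W where "W = (\<lambda>x. u x * P x - p x * U x)"
  have "(W has_derivative (\<lambda>h. 0)) (at x within {0<..<L})" if "x \<in> {0<..<L}" for x
  proof -
    have ders: "(u has_vector_derivative p x / of_real (w x)) (at x)"
      "(p has_vector_derivative - \<mu> * of_real (w x * N x) * u x) (at x)"
      "(U has_vector_derivative P x / of_real (w x)) (at x)"
      "(P has_vector_derivative - \<mu> * of_real (w x * N x) * U x) (at x)"
      using assms that by (auto simp: sl_solution_def)
    have "(W has_vector_derivative (u x * (- \<mu> * of_real (w x * N x) * U x) + p x / of_real (w x) * P x)
        - (p x * (P x / of_real (w x)) + - \<mu> * of_real (w x * N x) * u x * U x)) (at x)"
      unfolding W_def by (intro has_vector_derivative_diff has_vector_derivative_mult ders)
    then have "(W has_vector_derivative 0) (at x)" by (simp add: algebra_simps)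
    then show ?thesis
      unfolding has_vector_derivative_def by (auto intro: has_derivative_at_withinI)
  qed
  then obtain c where "\<And>x. x \<in> {0<..<L} \<Longrightarrow> W x = c"
    using has_derivative_zero_constant[of "{0<..<L}" W] by auto
  then show ?thesis using that unfolding W_def by blast
qed

lemma sl_wronskian_at_end:
  assumes L: "0 < L" and sol: "sl_solution L w N \<mu> u p" "sl_solution L w N \<mu> U P"
    and W0: "((\<lambda>x. u x * P x - p x * U x) \<longlongrightarrow> 0) (at_right 0)"
    and lim: "(u \<longlongrightarrow> a) (at_left L)" "(p \<longlongrightarrow> b) (at_left L)" "(U \<longlongrightarrow> A) (at_left L)" "(P \<longlongrightarrow> B) (at_left L)"
  shows "a * B - b * A = 0"
proof -
  obtain c where c: "\<And>x. x \<in> {0<..<L} \<Longrightarrow> u x * P x - p x * U x = c"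
    using sl_wronskian_constant[OF sol] by metis
  have "\<forall>\<^sub>F x in at_right 0. x \<in> {0<..<L}" "\<forall>\<^sub>F x in at_left L. x \<in> {0<..<L}"
    using eventually_at_right_real[OF L] eventually_at_left_real[OF L] .
  then have "\<forall>\<^sub>F x in at_right 0. u x * P x - p x * U x = c"
    "\<forall>\<^sub>F x in at_left L. u x * P x - p x * U x = c"
    by (auto elim!: eventually_mono simp: c)
  then have "((\<lambda>x. u x * P x - p x * U x) \<longlongrightarrow> c) (at_right 0)"
    "((\<lambda>x. u x * P x - p x * U x) \<longlongrightarrow> c) (at_left L)"
    by (auto intro: tendsto_eventually)
  moreover have "((\<lambda>x. u x * P x - p x * U x) \<longlongrightarrow> a * B - b * A) (at_left L)"
    by (intro tendsto_intros lim)
  ultimately show ?thesis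
    using W0 tendsto_unique[OF trivial_limit_at_right_real] tendsto_unique[OF trivial_limit_at_left_real] by metis
qed

section \<open>Backward uniqueness from the regular end\<close>

lemma has_real_derivative_inner_self:
  fixes f :: "real \<Rightarrow> complex"
  assumes "(f has_vector_derivative f') (at x)"
  shows "((\<lambda>x. (norm (f x))\<^sup>2) has_real_derivative 2 * (f x \<bullet> f')) (at x)"
proof -
  have "((\<lambda>x. f x \<bullet> f x) has_derivative (\<lambda>h. f x \<bullet> (h *\<^sub>R f') + h *\<^sub>R f' \<bullet> f x)) (at x)"
    using assms unfolding has_vector_derivative_def by (intro has_derivative_inner)
  moreover have "(\<lambda>h. f x \<bullet> (h *\<^sub>R f') + h *\<^sub>R f' \<bullet> f x) = (*) (2 * (f x \<bullet> f'))"
    by (auto simp: inner_commute)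
  ultimately show ?thesis
    by (simp add: has_field_derivative_def power2_norm_eq_inner)
qed

text \<open>Gronwall: \<open>e\<^sup>K\<^sup>x (|U|\<^sup>2 + |P|\<^sup>2)\<close> is nondecreasing away from the possibly singular end
  \<open>0\<close>, so vanishing data at \<open>L\<close> force the solution to vanish.\<close>

lemma (in sturm_liouville) solution_zero_if_zero_at_end:
  assumes sol: "sl_solution L w N \<mu> U P"
    and lim: "(U \<longlongrightarrow> 0) (at_left L)" "(P \<longlongrightarrow> 0) (at_left L)" and x: "x \<in> {0<..<L}"
  shows "U x = 0"
proof -
  have "w t \<noteq> 0" if "t \<in> {x..L}" for t
    using w_pos[of t] that x by auto
  then have "continuous_on {x..L} (\<lambda>t. 1 / w t)"
    using x by (intro continuous_intros continuous_on_subset[OF w_cont]) auto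
  then obtain b1 where b1: "\<And>t. t \<in> {x..L} \<Longrightarrow> \<bar>1 / w t\<bar> \<le> b1"
    using continuous_on_Icc_abs_le by blast
  have "continuous_on {x..L} (\<lambda>t. w t * N t)"
    using x by (intro continuous_intros continuous_on_subset[OF w_cont] continuous_on_subset[OF N_cont]) auto
  then obtain b2 where b2: "\<And>t. t \<in> {x..L} \<Longrightarrow> \<bar>w t * N t\<bar> \<le> b2"
    using continuous_on_Icc_abs_le by blast
  \<comment> \<open>\<open>b1\<close> bounds \<open>1 / w\<close> and \<open>b2\<close> bounds
    \<open>w * N\<close> on \<open>[x, L]\<close>, away from the singular end. By Cauchy-Schwarz
    half the derivative of \<open>E\<close> is at least \<open>- K |U| |P|\<close>, and
    \<open>2 |U| |P| \<le> E\<close>.\<close>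
  define K where "K = b1 + norm \<mu> * b2"
  define E where "E = (\<lambda>t. (norm (U t))\<^sup>2 + (norm (P t))\<^sup>2)"
  have mono: "exp (K * x) * E x \<le> exp (K * y) * E y" if y: "y \<in> {x..<L}" for y
  proof (rule DERIV_nonneg_imp_nondecreasing[where f = "\<lambda>t. exp (K * t) * E t"])
    fix t assume t: "x \<le> t" "t \<le> y"
    define U' where "U' = P t / of_real (w t)"
    define P' where "P' = - \<mu> * of_real (w t * N t) * U t"
    have "t \<in> {0<..<L}" using t x y by auto
    then have "(U has_vector_derivative U') (at t)" "(P has_vector_derivative P') (at t)"
      using sol by (auto simp: sl_solution_def U'_def P'_def)
    then have "(E has_real_derivative 2 * (U t \<bullet> U') + 2 * (P t \<bullet> P')) (at t)"
      unfolding E_def by (intro DERIV_add has_real_derivative_inner_self)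
    then have "((\<lambda>t. exp (K * t) * E t) has_real_derivative
        exp (K * t) * (K * E t + (2 * (U t \<bullet> U') + 2 * (P t \<bullet> P')))) (at t)"
      by (auto intro!: derivative_eq_intros simp: algebra_simps)
    moreover have "0 \<le> K * E t + (2 * (U t \<bullet> U') + 2 * (P t \<bullet> P'))"
    proof -
      have tL: "t \<in> {x..L}" using t y by auto
      have "norm U' = norm (P t) * \<bar>1 / w t\<bar>" by (simp add: U'_def norm_divide)
      also have "\<dots> \<le> norm (P t) * b1" by (intro mult_left_mono b1 tL) simp
      finally have "\<bar>U t \<bullet> U'\<bar> \<le> norm (U t) * (norm (P t) * b1)"
        by (rule order_trans[OF Cauchy_Schwarz_ineq2 mult_left_mono]) simp
      moreover have "norm P' = norm \<mu> * \<bar>w t * N t\<bar> * norm (U t)"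
        by (simp add: P'_def norm_mult abs_mult)
      then have "norm P' \<le> norm \<mu> * b2 * norm (U t)"
        using b2[OF tL] by (simp add: mult_left_mono mult_right_mono)
      then have "\<bar>P t \<bullet> P'\<bar> \<le> norm (P t) * (norm \<mu> * b2 * norm (U t))"
        by (rule order_trans[OF Cauchy_Schwarz_ineq2 mult_left_mono]) simp
      ultimately have "- (U t \<bullet> U' + P t \<bullet> P') \<le> K * (norm (U t) * norm (P t))"
        by (simp add: K_def algebra_simps)
      moreover have "2 * (norm (U t) * norm (P t)) \<le> E t"
        using sum_squares_bound[of "norm (U t)" "norm (P t)"] by (simp add: E_def mult.assoc)
      moreover have "0 \<le> K"
        using order_trans[OF abs_ge_zero b1[OF tL]] order_trans[OF abs_ge_zero b2[OF tL]]
        by (simp add: K_def)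
      ultimately show ?thesis
        using mult_left_mono[of "2 * (norm (U t) * norm (P t))" "E t" K] by simp
    qed
    ultimately show "\<exists>y. ((\<lambda>t. exp (K * t) * E t) has_real_derivative y) (at t) \<and> 0 \<le> y"
      by (meson exp_ge_zero mult_nonneg_nonneg)
  qed (use y in auto)
  have "((\<lambda>y. exp (K * y) * E y) \<longlongrightarrow> exp (K * L) * ((norm (0::complex))\<^sup>2 + (norm (0::complex))\<^sup>2)) (at_left L)"
    unfolding E_def by (intro tendsto_intros lim)
  then have "((\<lambda>y. exp (K * y) * E y) \<longlongrightarrow> 0) (at_left L)" by simp
  moreover have "\<forall>\<^sub>F y in at_left L. exp (K * x) * E x \<le> exp (K * y) * E y"
    using eventually_at_left_real[of x L] x mono by (auto elim!: eventually_mono)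
  ultimately have "exp (K * x) * E x \<le> 0"
    by (rule tendsto_lowerbound) simp
  then have "E x \<le> 0" by (simp add: mult_le_0_iff not_le)
  then show ?thesis
    unfolding E_def using zero_le_power2[of "norm (P x)"] zero_le_power2[of "norm (U x)"]
    by (metis add_nonneg_eq_0_iff antisym add_nonneg_nonneg norm_eq_zero power_eq_0_iff)
qed

section \<open>The shooting formula at the far end\<close>

lemma shooting_value:
  fixes a b A B g e :: complex
  assumes "a * B - b * A = 0" "b = g + e * a" "g \<noteq> 0" "A \<noteq> 0 \<or> B \<noteq> 0"
  shows "B - e * A \<noteq> 0 \<and> a = g * A / (B - e * A)"
proof -
  have eq: "a * (B - e * A) = g * A" using assms(1,2) by (simp add: algebra_simps)
  \<comment> \<open>Otherwise \<open>g * A = 0\<close>, hence \<open>A = 0\<close> and then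
    \<open>B = e * A = 0\<close>, which the last assumption excludes.\<close>
  have "B - e * A \<noteq> 0"
  proof
    assume "B - e * A = 0"
    then show False using eq assms(3,4) by auto
  qed
  then show ?thesis using eq by (simp add: field_simps)
qed

text \<open>The limit \<open>g + e * a\<close> encodes the inhomogeneous Robin condition at
  \<open>L\<close>. Since \<open>U 0 \<noteq> 0\<close>, \<open>solution_zero_if_zero_at_end\<close>
  forbids \<open>U\<close> and \<open>P\<close> to vanish together at \<open>L\<close>, the
  degenerate case of \<open>shooting_value\<close>.\<close>

lemma (in sturm_liouville) shooting_solution_value:
  assumes sol: "sl_solution L w N \<mu> u p" "sl_solution L w N \<mu> U P"
    and W0: "((\<lambda>x. u x * P x - p x * U x) \<longlongrightarrow> 0) (at_right 0)"
    and lim: "(u \<longlongrightarrow> a) (at_left L)" "(p \<longlongrightarrow> g + e * a) (at_left L)" and g: "g \<noteq> 0"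
    and cont: "continuous_on {0..L} U" "continuous_on {0..L} P" and nz: "U 0 \<noteq> 0"
  shows "P L - e * U L \<noteq> 0 \<and> a = g * U L / (P L - e * U L)"
proof -
  have lim_L: "(U \<longlongrightarrow> U L) (at_left L)" "(P \<longlongrightarrow> P L) (at_left L)"
    using cont L_pos by (auto simp: continuous_on_Icc_at_leftD)
  have U0: "(U \<longlongrightarrow> U 0) (at_right 0)"
    using cont L_pos by (auto simp: continuous_on_Icc_at_rightD)
  have "U L \<noteq> 0 \<or> P L \<noteq> 0"
  proof (rule ccontr)
    assume "\<not> (U L \<noteq> 0 \<or> P L \<noteq> 0)"
    then have "U x = 0" if "x \<in> {0<..<L}" for x
      using solution_zero_if_zero_at_end[OF sol(2) _ _ that] lim_L by simp
    then have "\<forall>\<^sub>F x in at_right 0. U x = 0"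
      using eventually_at_right_real[OF L_pos] by (auto elim!: eventually_mono)
    then have "(U \<longlongrightarrow> 0) (at_right 0)" by (rule tendsto_eventually)
    then show False using U0 nz tendsto_unique[OF trivial_limit_at_right_real] by metis
  qed
  then show ?thesis
    using shooting_value[OF sl_wronskian_at_end[OF L_pos sol W0 lim lim_L] refl g] by simp
qed

section \<open>Reduction of the radial problems\<close>

lemma filterlim_reflect_at_right: "filterlim (\<lambda>x::real. c - x) (at_left (c - a)) (at_right a)"
  unfolding filterlim_at
proof
  show "\<forall>\<^sub>F x in at_right a. c - x \<in> {..<c - a} \<and> c - x \<noteq> c - a"
    by (simp add: eventually_at_filter)
  show "((\<lambda>x. c - x) \<longlongrightarrow> c - a) (at_right a)" by (intro tendsto_intros)
qed

lemma filterlim_reflect_at_left: "filterlim (\<lambda>x::real. c - x) (at_right (c - a)) (at_left a)"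
  unfolding filterlim_at
proof
  show "\<forall>\<^sub>F x in at_left a. c - x \<in> {c - a<..} \<and> c - x \<noteq> c - a"
    by (simp add: eventually_at_filter)
  show "((\<lambda>x. c - x) \<longlongrightarrow> c - a) (at_left a)" by (intro tendsto_intros)
qed

lemma sl_solution_add_scaled:
  assumes "sl_solution L w N \<mu> u p" "sl_solution L w N \<mu> U P"
  shows "sl_solution L w N \<mu> (\<lambda>x. u x + c * U x) (\<lambda>x. p x + c * P x)"
  unfolding sl_solution_def
proof (intro ballI conjI)
  fix x assume "x \<in> {0<..<L}"
  then have ders: "(u has_vector_derivative p x / of_real (w x)) (at x)"
      "(p has_vector_derivative - \<mu> * of_real (w x * N x) * u x) (at x)"
      "(U has_vector_derivative P x / of_real (w x)) (at x)"
      "(P has_vector_derivative - \<mu> * of_real (w x * N x) * U x) (at x)"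
    using assms by (auto simp: sl_solution_def)
  have "((\<lambda>x. u x + c * U x) has_vector_derivative p x / of_real (w x) + c * (P x / of_real (w x))) (at x)"
    by (intro has_vector_derivative_add has_vector_derivative_mult_right ders)
  then show "((\<lambda>x. u x + c * U x) has_vector_derivative (p x + c * P x) / of_real (w x)) (at x)"
    by (simp add: add_divide_distrib)
  have "((\<lambda>x. p x + c * P x) has_vector_derivative
      - \<mu> * of_real (w x * N x) * u x + c * (- \<mu> * of_real (w x * N x) * U x)) (at x)"
    by (intro has_vector_derivative_add has_vector_derivative_mult_right ders)
  then show "((\<lambda>x. p x + c * P x) has_vector_derivative - \<mu> * of_real (w x * N x) * (u x + c * U x)) (at x)"
    by (simp add: algebra_simps)
qed

section \<open>Removal of the indicial exponent\<close>

definition scaled_value :: "nat \<Rightarrow> (real \<Rightarrow> complex) \<Rightarrow> real \<Rightarrow> complex" where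
  "scaled_value M v r = v r / of_real r ^ M"

text \<open>This is \<open>r^(2 M + 1)\<close> times the derivative of \<open>v / r^M\<close>,
  multiplied out so that no negative power of \<open>r\<close> remains.\<close>

definition scaled_flux :: "nat \<Rightarrow> (real \<Rightarrow> complex) \<Rightarrow> real \<Rightarrow> complex" where
  "scaled_flux M v r = of_real r ^ M * (of_real r * vderiv v r - of_nat M * v r)"

text \<open>\<open>Ck_on\<close> speaks of Frechet derivatives in direction 1,
  \<open>radial_op\<close> of vector derivatives, which carry information only where they exist. The
  regularity supplies the existence of \<open>(r v')'\<close>, and only then does the equation give
  its value.\<close>

lemma radial_solution_derivatives:
  assumes sol: "radial_solution \<tau> nhat m k v" and \<tau>: "open \<tau>" and r: "r \<in> \<tau>" "0 < r"
  shows "(v has_vector_derivative vderiv v r) (at r)"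
    and "((\<lambda>s. of_real s * vderiv v s) has_vector_derivative
      ((of_int m)\<^sup>2 / of_real r - (k * of_real (nhat r))\<^sup>2 * of_real r) * v r) (at r)"
proof -
  have C2: "v differentiable_on \<tau>" "(\<lambda>x. frechet_derivative v (at x) 1) differentiable_on \<tau>"
    using sol by (auto simp: radial_solution_def numeral_2_eq_2)
  have diff: "v differentiable (at s)" if "s \<in> \<tau>" for s
    using C2(1) \<tau> that by (simp add: differentiable_on_eq_differentiable_at)
  then have v': "(v has_vector_derivative vderiv v s) (at s)" if "s \<in> \<tau>" for s
    using that vector_derivative_works by blast
  show "(v has_vector_derivative vderiv v r) (at r)" using v' r by blast
  have eq: "frechet_derivative v (at s) 1 = vderiv v s" if "s \<in> \<tau>" for s
    using frechet_derivative_at[OF v'[OF that, unfolded has_vector_derivative_def]]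
    by (metis scaleR_one)
  have "(\<lambda>x. frechet_derivative v (at x) 1) differentiable (at r)"
    using C2(2) \<tau> r by (simp add: differentiable_on_eq_differentiable_at)
  then obtain D where "((\<lambda>x. frechet_derivative v (at x) 1) has_derivative D) (at r)"
    unfolding differentiable_def by blast
  then have "(vderiv v has_derivative D) (at r)"
    by (rule has_derivative_transform_within_open[OF _ \<tau> r(1)]) (rule eq)
  then have "(\<lambda>s. of_real s * vderiv v s) differentiable (at r)"
    by (intro differentiable_mult differentiableI[OF bounded_linear_imp_has_derivative[OF bounded_linear_of_real]])
       (rule differentiableI)
  then have "((\<lambda>s. of_real s * vderiv v s) has_vector_derivative
      vderiv (\<lambda>s. of_real s * vderiv v s) r) (at r)"
    using vector_derivative_works by blast
  moreover have "vderiv (\<lambda>s. of_real s * vderiv v s) r =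
      ((of_int m)\<^sup>2 / of_real r - (k * of_real (nhat r))\<^sup>2 * of_real r) * v r"
  proof -
    have "radial_op nhat m k v r = 0" using sol r by (simp add: radial_solution_def)
    then have "vderiv (\<lambda>s. of_real s * vderiv v s) r / of_real r =
        ((of_int m)\<^sup>2 / (of_real r)\<^sup>2 - (k * of_real (nhat r))\<^sup>2) * v r"
      by (simp add: radial_op_def)
    moreover have "complex_of_real r \<noteq> 0" using r(2) by simp
    ultimately have "vderiv (\<lambda>s. of_real s * vderiv v s) r =
        of_real r * (((of_int m)\<^sup>2 / (of_real r)\<^sup>2 - (k * of_real (nhat r))\<^sup>2) * v r)"
      by (metis nonzero_divide_eq_eq mult.commute)
    also have "\<dots> = ((of_int m)\<^sup>2 / of_real r - (k * of_real (nhat r))\<^sup>2 * of_real r) * v r"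
      by (simp add: power2_eq_square right_diff_distrib left_diff_distrib)
    finally show ?thesis .
  qed
  ultimately show "((\<lambda>s. of_real s * vderiv v s) has_vector_derivative
      ((of_int m)\<^sup>2 / of_real r - (k * of_real (nhat r))\<^sup>2 * of_real r) * v r) (at r)" by simp
qed

text \<open>Because \<open>M^2 = m^2\<close>, the power \<open>r^M\<close> solves the equation for
  \<open>k = 0\<close>; hence in the derivative of the flux the terms with \<open>M^2\<close> and
  with \<open>v'\<close> cancel and only the spectral term is left.\<close>

lemma scaled_derivatives:
  assumes sol: "radial_solution \<tau> nhat m k v" and \<tau>: "open \<tau>" and r: "r \<in> \<tau>" "0 < r"
    and M: "M = nat \<bar>m\<bar>"
  shows "(scaled_value M v has_vector_derivative scaled_flux M v r / of_real (r ^ (2 * M + 1))) (at r)"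
    and "(scaled_flux M v has_vector_derivative
      - k\<^sup>2 * of_real (r ^ (2 * M + 1) * (nhat r)\<^sup>2) * scaled_value M v r) (at r)"
proof -
  note v' = radial_solution_derivatives(1)[OF sol \<tau> r]
    and q' = radial_solution_derivatives(2)[OF sol \<tau> r]
  define z where "z = complex_of_real r"
  have z: "z \<noteq> 0" using r by (simp add: z_def)
  have dpow: "((\<lambda>z. z ^ M) has_field_derivative of_nat M * z ^ M / z) (at z)"
  proof -
    have "((\<lambda>z. z ^ M) has_field_derivative of_nat M * (1 * z ^ (M - Suc 0))) (at z)"
      by (rule DERIV_power[OF DERIV_ident])
    moreover have "of_nat M * (1 * z ^ (M - Suc 0)) = of_nat M * z ^ M / z"
      using z by (cases M) auto
    ultimately show ?thesis by simp
  qed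
  have pow: "((\<lambda>s. complex_of_real s ^ M) has_vector_derivative of_nat M * z ^ M / z) (at r)"
    by (rule has_vector_derivative_real_field) (use dpow in \<open>simp add: z_def\<close>)
  have inverse_square: "- (a * b / z * inverse (b ^ Suc (Suc 0))) = - a / (b * z)" if "b \<noteq> 0" for a b
    using z that by (simp add: field_simps)
  have "((\<lambda>z. inverse (z ^ M)) has_field_derivative
      - (of_nat M * z ^ M / z * inverse ((z ^ M) ^ Suc (Suc 0)))) (at z)"
    by (rule DERIV_inverse_fun[OF dpow]) (use z in simp)
  also have "- (of_nat M * z ^ M / z * inverse ((z ^ M) ^ Suc (Suc 0))) = - of_nat M / (z ^ M * z)"
    by (rule inverse_square) (use z in simp)
  finally have inv: "((\<lambda>s. inverse (complex_of_real s ^ M)) has_vector_derivative - of_nat M / (z ^ M * z)) (at r)"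
    unfolding z_def by (rule has_vector_derivative_real_field)
  define Z where "Z = z ^ M"
  have Z: "Z \<noteq> 0" using z by (simp add: Z_def)
  have zw: "complex_of_real (r ^ (2 * M + 1)) = Z * Z * z"
    by (simp add: Z_def z_def power_add mult_2)
  have "complex_of_int (\<bar>m\<bar>\<^sup>2) = complex_of_int ((int M)\<^sup>2)" by (simp only: M nat_0_le abs_ge_zero)
  then have m2: "(of_int m)\<^sup>2 = (of_nat M :: complex)\<^sup>2"
    by (simp only: power2_abs of_int_power of_int_of_nat_eq)
  have "((\<lambda>s. v s * inverse (complex_of_real s ^ M)) has_vector_derivative
      v r * (- of_nat M / (z ^ M * z)) + vderiv v r * inverse (complex_of_real r ^ M)) (at r)"
    by (intro has_vector_derivative_mult v' inv)
  moreover have "v r * (- of_nat M / (Z * z)) + vderiv v r * inverse Z =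
      Z * (z * vderiv v r - of_nat M * v r) / (Z * Z * z)"
    using z Z by (simp add: field_simps)
  ultimately show "(scaled_value M v has_vector_derivative scaled_flux M v r / of_real (r ^ (2 * M + 1))) (at r)"
    unfolding scaled_value_def[abs_def] scaled_flux_def zw divide_inverse
    by (simp add: Z_def z_def divide_inverse)
  have "(scaled_flux M v has_vector_derivative
      of_real r ^ M * (((of_int m)\<^sup>2 / of_real r - (k * of_real (nhat r))\<^sup>2 * of_real r) * v r
          - of_nat M * vderiv v r) +
        of_nat M * z ^ M / z * (of_real r * vderiv v r - of_nat M * v r)) (at r)"
    unfolding scaled_flux_def[abs_def]
    by (intro has_vector_derivative_mult has_vector_derivative_diff has_vector_derivative_mult_right pow v' q')
  then have flux': "(scaled_flux M v has_vector_derivative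
      Z * (((of_nat M)\<^sup>2 / z - (k * of_real (nhat r))\<^sup>2 * z) * v r - of_nat M * vderiv v r) +
        of_nat M * Z / z * (z * vderiv v r - of_nat M * v r)) (at r)"
    unfolding m2 Z_def z_def .
  have "Z * ((a\<^sup>2 / z - (k * n)\<^sup>2 * z) * x - a * y) + a * Z / z * (z * y - a * x) =
      - k\<^sup>2 * (Z * Z * z * n\<^sup>2) * (x / Z)" for a n x y
    using z Z by (simp add: field_simps power2_eq_square)
  from this[of "of_nat M" "of_real (nhat r)" "v r" "vderiv v r"] flux'
  show "(scaled_flux M v has_vector_derivative
      - k\<^sup>2 * of_real (r ^ (2 * M + 1) * (nhat r)\<^sup>2) * scaled_value M v r) (at r)"
    unfolding of_real_mult zw of_real_power[of "nhat r"] scaled_value_def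
    by (simp only: Z_def z_def)
qed

section \<open>Limits at the endpoints and behaviour at the origin\<close>

lemma scaled_tendsto:
  assumes "has_endpoint_data F v a b" and \<rho>: "((\<lambda>r. r) \<longlongrightarrow> \<rho>) F" "\<rho> \<noteq> 0"
  shows "(scaled_value M v \<longlongrightarrow> a / of_real \<rho> ^ M) F"
    and "(scaled_flux M v \<longlongrightarrow> of_real \<rho> ^ M * (of_real \<rho> * b - of_nat M * a)) F"
proof -
  have v: "(v \<longlongrightarrow> a) F" "(vderiv v \<longlongrightarrow> b) F"
    using assms(1) by (auto simp: has_endpoint_data_def)
  have r: "((\<lambda>r. complex_of_real r) \<longlongrightarrow> of_real \<rho>) F"
    by (rule tendsto_of_real[OF \<rho>(1)])
  show "(scaled_value M v \<longlongrightarrow> a / of_real \<rho> ^ M) F"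
    unfolding scaled_value_def[abs_def]
    by (intro tendsto_divide tendsto_power v r) (use \<rho>(2) in simp)
  show "(scaled_flux M v \<longlongrightarrow> of_real \<rho> ^ M * (of_real \<rho> * b - of_nat M * a)) F"
    unfolding scaled_flux_def[abs_def]
    by (intro tendsto_mult tendsto_diff tendsto_power tendsto_const v r)
qed

text \<open>The index lives on open intervals, whereas \<open>sturm_liouville\<close> asks for
  coefficients that are continuous up to both ends.\<close>

lemma lipschitz_open_interval_extension:
  fixes f :: "real \<Rightarrow> real"
  assumes "L-lipschitz_on {a<..<b} f" "a < b"
  obtains g where "continuous_on {a..b} g" "\<And>x. x \<in> {a<..<b} \<Longrightarrow> f x = g x"
proof -
  obtain g where g: "L-lipschitz_on (closure {a<..<b}) g" "\<forall>x\<in>{a<..<b}. g x = f x"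
    using lipschitz_extend_closure[OF assms(1)] by auto
  have "continuous_on {a..b} g"
    using lipschitz_on_continuous_on[OF g(1)] assms(2) by simp
  then show ?thesis using that g(2) by simp
qed

text \<open>For even \<open>m\<close> the condition at 0 concerns \<open>v'\<close> alone; the mean
  value inequality from a fixed interior point turns it into the boundedness of \<open>v\<close>
  needed to rule out the singular solution.\<close>

lemma bounded_near_zero_if_vderiv_bounded:
  fixes v :: "real \<Rightarrow> complex"
  assumes b: "0 < b" and v': "\<And>r. r \<in> {0<..<b} \<Longrightarrow> (v has_vector_derivative vderiv v r) (at r)"
    and lim: "(vderiv v \<longlongrightarrow> l) (at_right 0)"
  shows "\<exists>B. \<forall>\<^sub>F r in at_right 0. norm (v r) \<le> B"
proof -
  have "\<forall>\<^sub>F r in at_right 0. dist (vderiv v r) l < 1"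
    using tendstoD[OF lim] by simp
  then obtain d where d: "0 < d" "\<And>r. 0 < r \<Longrightarrow> r < d \<Longrightarrow> dist (vderiv v r) l < 1"
    unfolding eventually_at_right_field by auto
  define c where "c = min b d"
  have c: "0 < c" using b d by (simp add: c_def)
  define K where "K = norm l + 1"
  have le: "norm (vderiv v r) \<le> K" if "r \<in> {0<..<c}" for r
    using d(2)[of r] that norm_triangle_ineq2[of "vderiv v r" l] by (auto simp: c_def K_def dist_norm)
  have "norm (v r - v (c / 2)) \<le> K * norm (r - c / 2)" if "r \<in> {0<..<c}" for r
  proof (rule differentiable_bound[where S = "{0<..<c}" and f' = "\<lambda>r h. h *\<^sub>R vderiv v r"])
    fix s assume s: "s \<in> {0<..<c}"
    then show "(v has_derivative (\<lambda>h. h *\<^sub>R vderiv v s)) (at s within {0<..<c})"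
      using v'[of s] unfolding has_vector_derivative_def c_def by (auto intro: has_derivative_at_withinI)
    show "onorm (\<lambda>h. h *\<^sub>R vderiv v s) \<le> K"
      using mult_left_mono[OF le[OF s] abs_ge_zero] by (intro onorm_le) (simp add: mult.commute[of K])
  qed (use that c in auto)
  moreover have "K * norm (r - c / 2) \<le> K * c" if "r \<in> {0<..<c}" for r
    using that c by (intro mult_left_mono) (auto simp: K_def add_nonneg_nonneg abs_le_iff)
  ultimately have "norm (v r) \<le> norm (v (c / 2)) + K * c" if "r \<in> {0<..<c}" for r
    using that norm_triangle_ineq2[of "v r" "v (c / 2)"] by fastforce
  then show ?thesis
    by (intro exI[of _ "norm (v (c / 2)) + K * c"] eventually_mono[OF eventually_at_right_real[OF c]])
qed

text \<open>If the Wronskian were a constant \<open>c \<noteq> 0\<close>, then \<open>p\<close> would tend to \<open>- c\<close>. For \<open>M = 0\<close> this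
  contradicts \<open>v'(0) = 0\<close>; for \<open>M > 0\<close> integrating \<open>u' = p / w\<close> shows that \<open>v\<close> grows like
  \<open>r\<^sup>-\<^sup>M\<close>, the singular solution, whereas \<open>v\<close> is bounded.\<close>

lemma F1_wronskian_at_zero:
  fixes v :: "real \<Rightarrow> complex" and M :: nat
  defines "u \<equiv> scaled_value M v" and "p \<equiv> scaled_flux M v" and "w \<equiv> \<lambda>r::real. r ^ (2 * M + 1)"
  assumes \<xi>: "0 < \<xi>" and v: "\<forall>\<^sub>F r in at_right 0. norm (v r) \<le> B"
    and v': "M = 0 \<Longrightarrow> (vderiv v \<longlongrightarrow> 0) (at_right 0)"
    and sol: "sl_solution \<xi> w N \<mu> u p" "sl_solution \<xi> w N \<mu> U P"
    and U: "(U \<longlongrightarrow> 1) (at_right 0)" and P: "\<And>r. r \<in> {0..\<xi>} \<Longrightarrow> norm (P r) \<le> K * w r"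
  shows "((\<lambda>r. u r * P r - p r * U r) \<longlongrightarrow> 0) (at_right 0)"
proof -
  obtain c where c: "\<And>r. r \<in> {0<..<\<xi>} \<Longrightarrow> u r * P r - p r * U r = c"
    using sl_wronskian_constant[OF sol] by metis
  note near = eventually_at_right_real[OF \<xi>]
  have r0: "((\<lambda>r::real. r) \<longlongrightarrow> 0) (at_right 0)" by (rule tendsto_ident_at)
  have W: "((\<lambda>r. u r * P r - p r * U r) \<longlongrightarrow> c) (at_right 0)"
    by (rule tendsto_eventually, rule eventually_mono[OF near]) (rule c)
  \<comment> \<open>\<open>u = O(r^-M)\<close> because \<open>v\<close> is bounded, while
    \<open>P = O(r^(2 M + 1))\<close>.\<close>
  have uP: "((\<lambda>r. u r * P r) \<longlongrightarrow> 0) (at_right 0)"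
  proof (rule Lim_null_comparison)
    show "\<forall>\<^sub>F r in at_right 0. norm (u r * P r) \<le> B * K * r ^ (M + 1)"
      using near v
    proof eventually_elim
      case (elim r)
      have "norm (u r) \<le> B / r ^ M"
        using elim by (simp add: u_def scaled_value_def norm_divide norm_power divide_right_mono)
      moreover have "norm (P r) \<le> K * w r" using P elim by simp
      moreover have "0 \<le> B" using elim norm_ge_zero order_trans by blast
      then have "0 \<le> B / r ^ M" using elim by simp
      ultimately have "norm (u r) * norm (P r) \<le> (B / r ^ M) * (K * w r)"
        by (intro mult_mono) auto
      also have "\<dots> = B * K * r ^ (M + 1)"
        using elim by (simp add: w_def power_add mult_2)
      finally show ?case by (simp add: norm_mult)
    qed
    have "((\<lambda>r. B * K * r ^ (M + 1)) \<longlongrightarrow> B * K * 0 ^ (M + 1)) (at_right 0)"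
      by (intro tendsto_mult tendsto_const tendsto_power r0)
    then show "((\<lambda>r. B * K * r ^ (M + 1)) \<longlongrightarrow> 0) (at_right 0)" by simp
  qed
  have pU: "((\<lambda>r. p r * U r) \<longlongrightarrow> - c) (at_right 0)"
    using tendsto_diff[OF uP W] by simp
  have "((\<lambda>r. p r * U r / U r) \<longlongrightarrow> - c / 1) (at_right 0)"
    by (intro tendsto_divide pU U) simp
  moreover have "\<forall>\<^sub>F r in at_right 0. U r \<noteq> 0"
    by (rule tendsto_imp_eventually_ne[OF U]) simp
  then have "\<forall>\<^sub>F r in at_right 0. p r * U r / U r = p r"
    by (rule eventually_mono) simp
  ultimately have p: "(p \<longlongrightarrow> - c) (at_right 0)"
    using tendsto_cong by fastforce
  have "c = 0"
  proof (cases "M = 0")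
    case True
    have "((\<lambda>r. of_real r * vderiv v r) \<longlongrightarrow> of_real 0 * 0) (at_right 0)"
      by (intro tendsto_mult tendsto_of_real r0 v'[OF True])
    then have "(p \<longlongrightarrow> 0) (at_right 0)"
      by (simp add: p_def scaled_flux_def[abs_def] True)
    then show ?thesis
      using p tendsto_unique[OF trivial_limit_at_right_real] by fastforce
  next
    case False
    show ?thesis
    proof (rule ccontr)
      assume "c \<noteq> 0"
      \<comment> \<open>Normalising by the limit \<open>d\<close> of \<open>p\<close> makes
        \<open>Re (p r / d)\<close> tend to 1, hence exceed 1/2 near 0.\<close>
      define d where "d = - c"
      have d: "d \<noteq> 0" using \<open>c \<noteq> 0\<close> by (simp add: d_def)
      have "((\<lambda>r. Re (p r / d)) \<longlongrightarrow> Re (d / d)) (at_right 0)"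
        unfolding d_def by (intro tendsto_Re tendsto_divide p tendsto_const) (use \<open>c \<noteq> 0\<close> in simp)
      then have "\<forall>\<^sub>F r in at_right 0. 1 / 2 < Re (p r / d)"
        using d by (intro order_tendstoD(1)) auto
      then obtain b where b: "0 < b" "\<And>r. 0 < r \<Longrightarrow> r < b \<Longrightarrow> 1 / 2 < Re (p r / d)"
        unfolding eventually_at_right_field by auto
      define s where "s = min b \<xi> / 2"
      have s: "0 < s" "s < b" "s < \<xi>" using b(1) \<xi> by (auto simp: s_def)
      \<comment> \<open>The second summand has derivative \<open>- 1 / (2 * w)\<close>, which is
        outweighed by \<open>Re (p / d) / w\<close>; so \<open>F\<close> is nondecreasing on
        \<open>(0, s]\<close>.\<close>
      define F where "F = (\<lambda>r. Re (u r / d) + inverse (r ^ (2 * M)) / (4 * M))"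
      have F: "F r \<le> F s" if r: "0 < r" "r \<le> s" for r
      proof (rule DERIV_nonneg_imp_nondecreasing[OF r(2)])
        fix t assume t: "r \<le> t" "t \<le> s"
        have t0: "0 < t" "t < b" "t < \<xi>" using t r s by auto
        have "(u has_vector_derivative p t / of_real (w t)) (at t)"
          using sol(1) t0 by (simp add: sl_solution_def)
        then have "((\<lambda>t. u t / d) has_vector_derivative p t / of_real (w t) / d) (at t)"
          by (rule has_vector_derivative_divide)
        then have "((\<lambda>t. Re (u t / d)) has_real_derivative Re (p t / of_real (w t) / d)) (at t)"
          by (rule has_field_derivative_Re)
        moreover have "((\<lambda>t. inverse (t ^ (2 * M)) / (4 * M)) has_real_derivative
            - (1 / (2 * w t))) (at t)"
        proof -
          have "((\<lambda>t. inverse (t ^ (2 * M))) has_real_derivative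
              - (real (2 * M) * t ^ (2 * M - Suc 0) * inverse ((t ^ (2 * M)) ^ Suc (Suc 0)))) (at t)"
            by (rule DERIV_inverse_fun[OF DERIV_pow]) (use t0 in simp)
          then have "((\<lambda>t. inverse (t ^ (2 * M)) / (4 * M)) has_real_derivative
              - (real (2 * M) * t ^ (2 * M - Suc 0) * inverse ((t ^ (2 * M)) ^ Suc (Suc 0))) / (4 * M)) (at t)"
            by (rule DERIV_cdivide)
          moreover have "t ^ (2 * M) = t ^ (2 * M - Suc 0) * t"
            using False by (cases M) (simp_all add: mult_ac)
          then have "- (real (2 * M) * t ^ (2 * M - Suc 0) * inverse ((t ^ (2 * M)) ^ Suc (Suc 0))) / (4 * M)
              = - (1 / (2 * w t))"
            using t0 False by (simp add: w_def field_simps)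
          ultimately show ?thesis by simp
        qed
        ultimately have "(F has_real_derivative Re (p t / of_real (w t) / d) + - (1 / (2 * w t))) (at t)"
          unfolding F_def by (rule DERIV_add)
        moreover have "Re (p t / of_real (w t) / d) = Re (p t / d) / w t"
          by (simp add: Re_divide_of_real[symmetric] divide_divide_eq_left mult.commute del: Re_divide_of_real)
        moreover have "0 < w t" using t0 by (simp add: w_def)
        moreover have "0 \<le> Re (p t / d) / w t - 1 / (2 * w t)"
        proof -
          have "1 / 2 / w t \<le> Re (p t / d) / w t"
            using b(2)[OF t0(1,2)] \<open>0 < w t\<close> by (intro divide_right_mono) auto
          then show ?thesis by simp
        qed
        ultimately show "\<exists>y. (F has_real_derivative y) (at t) \<and> 0 \<le> y" by auto
      qed
      have "((\<lambda>r. r ^ (2 * M) * F s - r ^ (2 * M) * Re (u r / d)) \<longlongrightarrow> 0) (at_right 0)"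
      proof -
        have z: "((\<lambda>r. r ^ (2 * M) * F s) \<longlongrightarrow> 0 ^ (2 * M) * F s) (at_right 0)"
          "((\<lambda>r. r ^ M * (B / norm d)) \<longlongrightarrow> 0 ^ M * (B / norm d)) (at_right 0)"
          by (intro tendsto_mult tendsto_power r0 tendsto_const)+
        have "((\<lambda>r. r ^ (2 * M) * Re (u r / d)) \<longlongrightarrow> 0) (at_right 0)"
        proof (rule Lim_null_comparison)
          show "\<forall>\<^sub>F r in at_right 0. norm (r ^ (2 * M) * Re (u r / d)) \<le> r ^ M * (B / norm d)"
            using near v
          proof eventually_elim
            case (elim r)
            have "\<bar>Re (u r / d)\<bar> \<le> norm (u r / d)" by (rule abs_Re_le_cmod)
            also have "\<dots> = norm (v r) / r ^ M / norm d"
              using elim by (simp add: u_def scaled_value_def norm_divide norm_mult norm_power)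
            also have "\<dots> \<le> B / r ^ M / norm d"
              using elim by (intro divide_right_mono) auto
            finally have "r ^ (2 * M) * \<bar>Re (u r / d)\<bar> \<le> r ^ (2 * M) * (B / r ^ M / norm d)"
              using elim by (intro mult_left_mono) auto
            also have "\<dots> = r ^ M * (B / norm d)" using elim by (simp add: mult_2 power_add)
            finally show ?case using elim by (simp add: abs_mult)
          qed
          show "((\<lambda>r. r ^ M * (B / norm d)) \<longlongrightarrow> 0) (at_right 0)"
            using z(2) False by (simp add: power_0_left)
        qed
        from tendsto_diff[OF z(1) this] False show ?thesis by (simp add: power_0_left)
      qed
      \<comment> \<open>Multiplying \<open>F r \<le> F s\<close> by \<open>r^(2 M)\<close> isolates
        the positive constant \<open>1 / (4 M)\<close> below a quantity that has just been shown to
        tend to 0.\<close>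
      moreover have "\<forall>\<^sub>F r in at_right 0. 1 / (4 * real M) \<le> r ^ (2 * M) * F s - r ^ (2 * M) * Re (u r / d)"
        using eventually_at_right_real[OF s(1)]
      proof eventually_elim
        case (elim r)
        have "r ^ (2 * M) * F r \<le> r ^ (2 * M) * F s"
          using F[of r] elim by (intro mult_left_mono) auto
        moreover have "r ^ (2 * M) * F r = r ^ (2 * M) * Re (u r / d) + 1 / (4 * real M)"
        proof -
          have "r ^ (2 * M) * (inverse (r ^ (2 * M)) / (4 * M)) = 1 / (4 * real M)"
            using elim by simp
          then show ?thesis unfolding F_def distrib_left by simp
        qed
        ultimately show ?case by simp
      qed
      ultimately have "1 / (4 * real M) \<le> 0"
        by (rule tendsto_lowerbound) simp
      then show False using False by simp
    qed
  qed
  then show ?thesis using W by simp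
qed

section \<open>Endpoint values of the radial solutions as quotients\<close>

text \<open>\<open>A\<close> and \<open>D\<close> are fixed before \<open>k\<close>,
  \<open>h\<close> and \<open>v\<close>. An identity valid for each \<open>k\<close> separately thus
  becomes analyticity in \<open>k\<close>, however the solutions were selected.\<close>

lemma F1_endpoint_value:
  fixes m :: int
  assumes \<xi>: "0 < \<xi>" and lip: "C-lipschitz_on {0<..<\<xi>} nhat"
  obtains A D :: "complex \<Rightarrow> complex" where "A holomorphic_on UNIV" "D holomorphic_on UNIV"
    "\<And>k h v. F1_solution \<xi> nhat m k h v \<Longrightarrow> h \<noteq> 0 \<Longrightarrow>
      D k \<noteq> 0 \<and> Lim (at_left \<xi>) v = h * A k / D k"
proof -
  define M where "M = nat \<bar>m\<bar>"
  define w where "w = (\<lambda>r::real. r ^ (2 * M + 1))"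
  obtain n where n: "continuous_on {0..\<xi>} n" "\<And>r. r \<in> {0<..<\<xi>} \<Longrightarrow> nhat r = n r"
    using lipschitz_open_interval_extension[OF lip \<xi>] by metis
  define N where "N = (\<lambda>r. (n r)\<^sup>2)"
  interpret sturm_liouville \<xi> 1 w N
  proof
    show "continuous_on {0..\<xi>} w" "continuous_on {0..\<xi>} N"
      unfolding w_def N_def by (intro continuous_intros n(1))+
    show "w t \<le> 1 * w s" if "0 \<le> t" "t \<le> s" for s t
      unfolding w_def mult_1 by (rule power_mono[OF that(2,1)])
  qed (use \<xi> in \<open>auto simp: w_def\<close>)
  obtain U P :: "complex \<Rightarrow> real \<Rightarrow> complex" where UP:
    "\<And>\<mu>. sl_solution \<xi> w N \<mu> (U \<mu>) (P \<mu>)"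
    "\<And>\<mu>. continuous_on {0..\<xi>} (U \<mu>)" "\<And>\<mu>. continuous_on {0..\<xi>} (P \<mu>)"
    "\<And>\<mu>. U \<mu> 0 = of_real 1" "\<And>\<mu>. P \<mu> 0 = of_real 0"
    "\<And>\<mu>. \<exists>K. \<forall>x\<in>{0..\<xi>}. norm (P \<mu> x) \<le> K * w x"
    "(\<lambda>\<mu>. U \<mu> \<xi>) holomorphic_on UNIV" "(\<lambda>\<mu>. P \<mu> \<xi>) holomorphic_on UNIV"
    by (rule solution_family[of "\<lambda>_. 1" 0 0]) auto
  define x where "x = complex_of_real \<xi>"
  have x: "x \<noteq> 0" using \<xi> by (simp add: x_def)
  \<comment> \<open>The Robin condition in the scaled unknowns: inserting
    \<open>b = h + i k n1 a\<close> into the limit of \<open>scaled_flux\<close> gives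
    \<open>g + e k * (a / x ^ M)\<close> with \<open>g = x ^ (M + 1) * h\<close>.\<close>
  define e where "e = (\<lambda>k. x ^ M * (x * (\<i> * k * of_real (n1_xi \<xi> nhat)) - of_nat M) * x ^ M)"
  define A where "A = (\<lambda>k::complex. x ^ M * (x ^ (M + 1) * U (k\<^sup>2) \<xi>))"
  define D where "D = (\<lambda>k. P (k\<^sup>2) \<xi> - e k * U (k\<^sup>2) \<xi>)"
  have sq: "(\<lambda>k::complex. k\<^sup>2) holomorphic_on UNIV" by (intro holomorphic_intros)
  show ?thesis
  proof (rule that[of A D])
    note hol = entire_compose[OF UP(7) sq] entire_compose[OF UP(8) sq]
    show "A holomorphic_on UNIV" unfolding A_def by (intro holomorphic_on_mult holomorphic_on_const hol)
    have "e holomorphic_on UNIV" unfolding e_def by (intro holomorphic_intros)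
    then show "D holomorphic_on UNIV"
      unfolding D_def by (intro holomorphic_on_diff holomorphic_on_mult hol)
    fix k h v assume sol: "F1_solution \<xi> nhat m k h v" and h: "h \<noteq> 0"
    have rad: "radial_solution {0<..<\<xi>} nhat m k v"
      using sol by (simp add: F1_solution_def)
    obtain a b where ab: "has_endpoint_data (at_left \<xi>) v a b" "b - \<i> * k * of_real (n1_xi \<xi> nhat) * a = h"
      using sol by (auto simp: F1_solution_def)
    have bc: "if odd m then (v \<longlongrightarrow> 0) (at_right 0) else (vderiv v \<longlongrightarrow> 0) (at_right 0)"
      using sol by (simp add: F1_solution_def)
    have v': "(v has_vector_derivative vderiv v r) (at r)" if "r \<in> {0<..<\<xi>}" for r
      using radial_solution_derivatives(1)[OF rad open_greaterThanLessThan that] that by simp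
    have sl: "sl_solution \<xi> w N (k\<^sup>2) (scaled_value M v) (scaled_flux M v)"
      unfolding sl_solution_def
    proof
      fix r assume r: "r \<in> {0<..<\<xi>}"
      then have "0 < r" by simp
      from scaled_derivatives[OF rad open_greaterThanLessThan r this M_def]
      show "(scaled_value M v has_vector_derivative scaled_flux M v r / of_real (w r)) (at r) \<and>
          (scaled_flux M v has_vector_derivative - k\<^sup>2 * of_real (w r * N r) * scaled_value M v r) (at r)"
        unfolding w_def N_def n(2)[OF r] by simp
    qed
    \<comment> \<open>Both parities of \<open>m\<close> enter the Wronskian argument only through
      boundedness of \<open>v\<close>, except for \<open>M = 0\<close>, where \<open>m\<close> is
      even and \<open>v'(0) = 0\<close> is used directly.\<close>
    obtain B where B: "\<forall>\<^sub>F r in at_right 0. norm (v r) \<le> B"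
    proof (cases "odd m")
      case True
      then have "(v \<longlongrightarrow> 0) (at_right 0)" using bc by simp
      then have "\<forall>\<^sub>F r in at_right 0. dist (v r) 0 < 1" by (rule tendstoD) simp
      then have "\<forall>\<^sub>F r in at_right 0. norm (v r) \<le> 1" by (rule eventually_mono) simp
      then show ?thesis by (rule that)
    next
      case False
      then have "(vderiv v \<longlongrightarrow> 0) (at_right 0)" using bc by simp
      from bounded_near_zero_if_vderiv_bounded[OF \<xi> v' this] show ?thesis using that by blast
    qed
    obtain K where K: "\<And>r. r \<in> {0..\<xi>} \<Longrightarrow> norm (P (k\<^sup>2) r) \<le> K * w r"
      using UP(6) by blast
    have W0: "((\<lambda>r. scaled_value M v r * P (k\<^sup>2) r - scaled_flux M v r * U (k\<^sup>2) r) \<longlongrightarrow> 0) (at_right 0)"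
    proof (rule F1_wronskian_at_zero[OF \<xi> B])
      show "(vderiv v \<longlongrightarrow> 0) (at_right 0)" if "M = 0"
        using bc that by (simp add: M_def)
      show "(U (k\<^sup>2) \<longlongrightarrow> 1) (at_right 0)"
        using continuous_on_Icc_at_rightD[OF UP(2) \<xi>, of "k\<^sup>2"] UP(4)[of "k\<^sup>2"] by simp
    qed (use sl UP(1) K in \<open>simp_all add: w_def\<close>)
    have lim: "(scaled_value M v \<longlongrightarrow> a / x ^ M) (at_left \<xi>)"
      "(scaled_flux M v \<longlongrightarrow> x ^ M * (x * b - of_nat M * a)) (at_left \<xi>)"
      using scaled_tendsto[OF ab(1) tendsto_ident_at] \<xi> by (simp_all add: x_def)
    define g where "g = x ^ (M + 1) * h"
    have "b = h + \<i> * k * of_real (n1_xi \<xi> nhat) * a" using ab(2) by (simp add: algebra_simps)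
    then have "x ^ M * (x * b - of_nat M * a) = g + e k * (a / x ^ M)"
      using x by (simp add: g_def e_def algebra_simps)
    note lim2 = lim(2)[unfolded this]
    have "g \<noteq> 0" using h x by (simp add: g_def)
    from shooting_solution_value[OF sl UP(1) W0 lim(1) lim2 this UP(2,3)] UP(4)
    have "D k \<noteq> 0" "a / x ^ M = g * U (k\<^sup>2) \<xi> / D k" by (simp_all add: D_def)
    then have "a = x ^ M * (g * U (k\<^sup>2) \<xi> / D k)" using x by (simp add: field_simps)
    then have "a = h * A k / D k" by (simp add: g_def A_def mult_ac)
    moreover have "Lim (at_left \<xi>) v = a"
      using ab(1) by (intro tendsto_Lim) (auto simp: has_endpoint_data_def)
    ultimately show "D k \<noteq> 0 \<and> Lim (at_left \<xi>) v = h * A k / D k" using \<open>D k \<noteq> 0\<close> by simp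
  qed
qed

text \<open>The problem on \<open>(\<xi>, 1)\<close> is reflected by \<open>r = 1 - x\<close>, which flips the sign of the flux. The
  initial data at \<open>r = 1\<close> are \<open>U = 1\<close>, \<open>P = M - \<beta>\<close>, hence the combination with the coefficient \<open>c\<close>.\<close>

lemma F2_endpoint_value:
  fixes m :: int
  assumes \<xi>: "0 < \<xi>" "\<xi> < 1" and lip: "C-lipschitz_on {\<xi><..<1} nhat"
  obtains A1 A2 D1 D2 :: "complex \<Rightarrow> complex" where
    "A1 holomorphic_on UNIV" "A2 holomorphic_on UNIV"
    "D1 holomorphic_on UNIV" "D2 holomorphic_on UNIV"
    "\<And>k h v c. F2_solution \<xi> nhat m k h v \<Longrightarrow> h \<noteq> 0 \<Longrightarrow>
      c = of_nat (nat \<bar>m\<bar>) - dtn_symbol m (k * of_real (n2_one nhat)) \<Longrightarrow>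
      D1 k + c * D2 k \<noteq> 0 \<and>
      Lim (at_right \<xi>) v = h * (A1 k + c * A2 k) / (D1 k + c * D2 k)"
proof -
  define M where "M = nat \<bar>m\<bar>"
  define L where "L = 1 - \<xi>"
  have L: "0 < L" "L < 1" using \<xi> by (simp_all add: L_def)
  define w where "w = (\<lambda>x::real. (1 - x) ^ (2 * M + 1))"
  obtain n where n: "continuous_on {\<xi>..1} n" "\<And>r. r \<in> {\<xi><..<1} \<Longrightarrow> nhat r = n r"
    using lipschitz_open_interval_extension[OF lip \<xi>(2)] by metis
  define N where "N = (\<lambda>x. (n (1 - x))\<^sup>2)"
  \<comment> \<open>The reflected weight decreases from 1 to \<open>\<xi> ^ (2 * M + 1)\<close>, so
    \<open>1 / c0\<close> is its minimum. The same constant serves as \<open>C\<close> and, for the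
    initial flux 1 below, as the bound \<open>A\<close> in \<open>solution_family\<close>.\<close>
  define c0 where "c0 = 1 / \<xi> ^ (2 * M + 1)"
  have w_lower: "1 \<le> c0 * w s" if "s \<le> L" for s
  proof -
    have "\<xi> ^ (2 * M + 1) \<le> w s"
      unfolding w_def using \<xi> that by (intro power_mono) (auto simp: L_def)
    then show ?thesis using \<xi> by (simp add: c0_def)
  qed
  have w_positive: "0 < w s" if "s \<le> L" for s
    using that \<xi> by (simp add: w_def L_def)
  have w_cont: "continuous_on {0..L} w"
    unfolding w_def by (intro continuous_intros)
  interpret sturm_liouville L c0 w N
  proof
    have "continuous_on {0..L} (\<lambda>x. n (1 - x))"
      by (rule continuous_on_compose2[OF n(1)]) (auto intro!: continuous_intros simp: L_def)
    then show "continuous_on {0..L} N"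
      unfolding N_def by (rule continuous_on_power)
    show "w t \<le> c0 * w s" if "0 \<le> t" "t \<le> s" "s \<le> L" for s t
    proof -
      have "w t \<le> 1" unfolding w_def using that L by (intro power_le_one) auto
      then show ?thesis using w_lower[OF that(3)] by simp
    qed
  qed (use L w_positive w_cont in \<open>auto intro: less_imp_le\<close>)
  obtain U1 P1 :: "complex \<Rightarrow> real \<Rightarrow> complex" where UP1:
    "\<And>\<mu>. sl_solution L w N \<mu> (U1 \<mu>) (P1 \<mu>)"
    "\<And>\<mu>. continuous_on {0..L} (U1 \<mu>)" "\<And>\<mu>. continuous_on {0..L} (P1 \<mu>)"
    "\<And>\<mu>. U1 \<mu> 0 = of_real 1" "\<And>\<mu>. P1 \<mu> 0 = of_real 0"
    "(\<lambda>\<mu>. U1 \<mu> L) holomorphic_on UNIV" "(\<lambda>\<mu>. P1 \<mu> L) holomorphic_on UNIV"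
    by (rule solution_family[of "\<lambda>_. 1" 0 0]) auto
  \<comment> \<open>The solution for \<open>\<mu> = 0\<close> with value 0 and flux 1 at the start;
    together with the constant 1 it spans all initial data.\<close>
  define V where "V = (\<lambda>x. integral {0..x} (\<lambda>t. 1 / w t))"
  have winv_cont: "continuous_on {0..L} (\<lambda>t. 1 / w t)"
    using w_positive by (intro continuous_on_divide w_cont continuous_on_const) (auto simp: less_imp_neq[symmetric])
  have V': "(V has_real_derivative 1 / w x) (at x within {0..L})" if "x \<in> {0..L}" for x
    unfolding V_def by (rule integral_has_real_derivative[OF winv_cont that])
  have "continuous_on {0..L} V"
    by (rule DERIV_continuous_on[OF V'])
  moreover have "(V has_real_derivative 1 / w x) (at x)" if "x \<in> {0<..<L}" for x
    using V'[of x] that at_within_interior[of x "{0..L}"] by simp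
  moreover have "\<bar>1\<bar> \<le> c0 * w x" if "x \<in> {0..L}" for x using w_lower[of x] that by simp
  moreover have "0 \<le> c0" using C_pos by simp
  ultimately obtain U2 P2 :: "complex \<Rightarrow> real \<Rightarrow> complex" where UP2:
    "\<And>\<mu>. sl_solution L w N \<mu> (U2 \<mu>) (P2 \<mu>)"
    "\<And>\<mu>. continuous_on {0..L} (U2 \<mu>)" "\<And>\<mu>. continuous_on {0..L} (P2 \<mu>)"
    "\<And>\<mu>. U2 \<mu> 0 = of_real (V 0)" "\<And>\<mu>. P2 \<mu> 0 = of_real 1"
    "(\<lambda>\<mu>. U2 \<mu> L) holomorphic_on UNIV" "(\<lambda>\<mu>. P2 \<mu> L) holomorphic_on UNIV"
    by (rule solution_family) auto
  have V0: "V 0 = 0" by (simp add: V_def)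
  define x where "x = complex_of_real \<xi>"
  have x: "x \<noteq> 0" using \<xi> by (simp add: x_def)
  \<comment> \<open>The sign of \<open>M\<close> is opposite to that in (F1), because reflection
    reverses the flux.\<close>
  define e where "e = (\<lambda>k. x ^ M * (x * (\<i> * k * of_real (n2_xi \<xi> nhat)) + of_nat M) * x ^ M)"
  define A1 where "A1 = (\<lambda>k::complex. x ^ M * (x ^ (M + 1) * U1 (k\<^sup>2) L))"
  define A2 where "A2 = (\<lambda>k::complex. x ^ M * (x ^ (M + 1) * U2 (k\<^sup>2) L))"
  define D1 where "D1 = (\<lambda>k. P1 (k\<^sup>2) L - e k * U1 (k\<^sup>2) L)"
  define D2 where "D2 = (\<lambda>k. P2 (k\<^sup>2) L - e k * U2 (k\<^sup>2) L)"
  have sq: "(\<lambda>k::complex. k\<^sup>2) holomorphic_on UNIV" by (intro holomorphic_intros)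
  show ?thesis
  proof (rule that[of A1 A2 D1 D2])
    note hol = entire_compose[OF UP1(6) sq] entire_compose[OF UP1(7) sq]
      entire_compose[OF UP2(6) sq] entire_compose[OF UP2(7) sq]
    show "A1 holomorphic_on UNIV" "A2 holomorphic_on UNIV"
      unfolding A1_def A2_def by (intro holomorphic_on_mult holomorphic_on_const hol)+
    have "e holomorphic_on UNIV" unfolding e_def by (intro holomorphic_intros)
    then show "D1 holomorphic_on UNIV" "D2 holomorphic_on UNIV"
      unfolding D1_def D2_def by (intro holomorphic_on_diff holomorphic_on_mult hol; assumption)+
    fix k h v c
    assume sol: "F2_solution \<xi> nhat m k h v" and h: "h \<noteq> 0"
      and "c = of_nat (nat \<bar>m\<bar>) - dtn_symbol m (k * of_real (n2_one nhat))"
    then have c: "c = of_nat M - dtn_symbol m (k * of_real (n2_one nhat))" by (simp add: M_def)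
    define U where "U = (\<lambda>y. U1 (k\<^sup>2) y + c * U2 (k\<^sup>2) y)"
    define P where "P = (\<lambda>y. P1 (k\<^sup>2) y + c * P2 (k\<^sup>2) y)"
    define u where "u = (\<lambda>y. scaled_value M v (1 - y))"
    define p where "p = (\<lambda>y. - scaled_flux M v (1 - y))"
    have UP: "sl_solution L w N (k\<^sup>2) U P"
      unfolding U_def P_def by (rule sl_solution_add_scaled[OF UP1(1) UP2(1)])
    have UP_cont: "continuous_on {0..L} U" "continuous_on {0..L} P"
      unfolding U_def P_def
      by (intro continuous_on_add continuous_on_mult continuous_on_const UP1(2,3) UP2(2,3))+
    have UP_0: "U 0 = 1" "P 0 = c"
      unfolding U_def P_def UP1(4,5) UP2(4,5) V0 by simp_all
    have rad: "radial_solution {\<xi><..<1} nhat m k v"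
      using sol by (simp add: F2_solution_def)
    obtain a b where ab: "has_endpoint_data (at_right \<xi>) v a b"
      "- b - \<i> * k * of_real (n2_xi \<xi> nhat) * a = h"
      using sol by (auto simp: F2_solution_def)
    obtain a1 b1 where ab1: "has_endpoint_data (at_left 1) v a1 b1"
      "b1 - dtn_symbol m (k * of_real (n2_one nhat)) * a1 = 0"
      using sol by (auto simp: F2_solution_def)
    have sl: "sl_solution L w N (k\<^sup>2) u p"
      unfolding sl_solution_def
    proof
      fix y assume "y \<in> {0<..<L}"
      then have r: "1 - y \<in> {\<xi><..<1}" "0 < 1 - y" using L by (auto simp: L_def)
      have refl: "((\<lambda>y. 1 - y) has_vector_derivative - 1) (at y)"
        by (auto intro!: derivative_eq_intros)
      note ders = scaled_derivatives[OF rad open_greaterThanLessThan r M_def]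
      have "(u has_vector_derivative - (scaled_flux M v (1 - y) / of_real (w y))) (at y)"
        using vector_diff_chain_at[OF refl ders(1)] by (simp add: u_def w_def o_def)
      moreover have "((\<lambda>y. scaled_flux M v (1 - y)) has_vector_derivative
          - (- k\<^sup>2 * of_real (w y * N y) * u y)) (at y)"
        using vector_diff_chain_at[OF refl ders(2)]
        by (simp add: u_def w_def N_def n(2)[OF r(1)] o_def)
      then have "(p has_vector_derivative - (- (- k\<^sup>2 * of_real (w y * N y) * u y))) (at y)"
        unfolding p_def by (rule has_vector_derivative_minus)
      ultimately show "(u has_vector_derivative p y / of_real (w y)) (at y) \<and>
          (p has_vector_derivative - k\<^sup>2 * of_real (w y * N y) * u y) (at y)"
        by (simp add: p_def)
    qed
    have refl0: "filterlim (\<lambda>y::real. 1 - y) (at_left 1) (at_right 0)"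
      using filterlim_reflect_at_right[of 1 0] by simp
    have reflL: "filterlim (\<lambda>y::real. 1 - y) (at_right \<xi>) (at_left L)"
      using filterlim_reflect_at_left[of 1 L] by (simp add: L_def)
    have lim0: "(u \<longlongrightarrow> a1) (at_right 0)" "(p \<longlongrightarrow> - (b1 - of_nat M * a1)) (at_right 0)"
      unfolding u_def p_def
      using filterlim_compose[OF scaled_tendsto(1)[OF ab1(1) tendsto_ident_at] refl0]
        tendsto_minus[OF filterlim_compose[OF scaled_tendsto(2)[OF ab1(1) tendsto_ident_at] refl0]]
      by simp_all
    have limL: "(u \<longlongrightarrow> a / x ^ M) (at_left L)"
      "(p \<longlongrightarrow> - (x ^ M * (x * b - of_nat M * a))) (at_left L)"
      unfolding u_def p_def x_def
      using filterlim_compose[OF scaled_tendsto(1)[OF ab(1) tendsto_ident_at] reflL]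
        tendsto_minus[OF filterlim_compose[OF scaled_tendsto(2)[OF ab(1) tendsto_ident_at] reflL]] \<xi>
      by simp_all
    \<comment> \<open>At \<open>r = 1\<close> both pairs obey the same relation,
      \<open>p = c * u\<close> and \<open>P = c * U\<close>, so the Wronskian tends to 0.\<close>
    have W0: "((\<lambda>y. u y * P y - p y * U y) \<longlongrightarrow> 0) (at_right 0)"
    proof -
      have "(U \<longlongrightarrow> 1) (at_right 0)" "(P \<longlongrightarrow> c) (at_right 0)"
        using continuous_on_Icc_at_rightD[OF UP_cont(1) L(1)] continuous_on_Icc_at_rightD[OF UP_cont(2) L(1)]
        by (simp_all add: UP_0)
      then have "((\<lambda>y. u y * P y - p y * U y) \<longlongrightarrow> a1 * c - - (b1 - of_nat M * a1) * 1) (at_right 0)"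
        by (intro tendsto_diff tendsto_mult lim0)
      moreover have "a1 * c - - (b1 - of_nat M * a1) * 1 = 0"
        using ab1(2) by (simp add: c algebra_simps)
      ultimately show ?thesis by simp
    qed
    define g where "g = x ^ (M + 1) * h"
    have b_eq: "b = - h - \<i> * k * of_real (n2_xi \<xi> nhat) * a"
      unfolding ab(2)[symmetric] by simp
    have "- (x ^ M * (x * b - of_nat M * a)) = g + e k * (a / x ^ M)"
      unfolding b_eq using x by (simp add: g_def e_def algebra_simps)
    note limL2 = limL(2)[unfolded this]
    have "g \<noteq> 0" using h x by (simp add: g_def)
    from shooting_solution_value[OF sl UP W0 limL(1) limL2 this UP_cont] UP_0
    have *: "P L - e k * U L \<noteq> 0" "a / x ^ M = g * U L / (P L - e k * U L)" by simp_all
    have D: "P L - e k * U L = D1 k + c * D2 k"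
      by (simp add: P_def U_def D1_def D2_def algebra_simps)
    have "a = x ^ M * (g * U L / (P L - e k * U L))" using *(2) x by (simp add: field_simps)
    also have "\<dots> = h * (A1 k + c * A2 k) / (P L - e k * U L)"
      by (simp add: g_def A1_def A2_def U_def distrib_left mult_ac)
    finally have "a = h * (A1 k + c * A2 k) / (D1 k + c * D2 k)" unfolding D .
    moreover have "Lim (at_right \<xi>) v = a"
      using ab(1) by (intro tendsto_Lim) (auto simp: has_endpoint_data_def)
    ultimately show "D1 k + c * D2 k \<noteq> 0 \<and>
        Lim (at_right \<xi>) v = h * (A1 k + c * A2 k) / (D1 k + c * D2 k)"
      using *(1) D by simp
  qed
qed

text \<open>Positivity makes scaling by \<open>n2_one nhat\<close> preserve openness and the lower
  half plane. As \<open>n2_one\<close> is a \<open>Lim\<close>, the limit must first be shown to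
  exist, which the Lipschitz extension does.\<close>

lemma n2_one_pos:
  assumes "admissible_index \<xi> nhat" "\<xi> < 1" "0 < \<xi>"
  shows "0 < n2_one nhat"
proof -
  obtain C c where "C-lipschitz_on {\<xi><..<1} nhat"
    and c: "0 < c" "\<And>r. r \<in> {0<..<1} \<Longrightarrow> c \<le> nhat r"
    using assms(1) by (auto simp: admissible_index_def)
  then obtain n where n: "continuous_on {\<xi>..1} n" "\<And>r. r \<in> {\<xi><..<1} \<Longrightarrow> nhat r = n r"
    using lipschitz_open_interval_extension[OF _ assms(2)] by metis
  have near: "\<forall>\<^sub>F r in at_left 1. r \<in> {\<xi><..<1}"
    by (rule eventually_at_left_real[OF assms(2)])
  have "(n \<longlongrightarrow> n 1) (at_left 1)"
    by (rule continuous_on_Icc_at_leftD[OF n(1) assms(2)])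
  then have lim: "(nhat \<longlongrightarrow> n 1) (at_left 1)"
    by (rule Lim_transform_eventually) (rule eventually_mono[OF near], simp add: n(2))
  then have "n2_one nhat = n 1" unfolding n2_one_def by (intro tendsto_Lim) simp
  moreover have "\<forall>\<^sub>F r in at_left 1. c \<le> nhat r"
    by (rule eventually_mono[OF near]) (use c(2) assms(3) in auto)
  then have "c \<le> n 1" by (rule tendsto_lowerbound[OF lim]) simp
  ultimately show ?thesis using c(1) by simp
qed

section \<open>Analyticity of the determinant and Newton's method for its root\<close>

theorem theorem8:
  fixes \<xi> :: real and nhat :: "real \<Rightarrow> real" and m :: int
    and kinf :: complex and \<omega> :: "complex set"
    and h1 h2 :: "complex \<Rightarrow> complex" and f1 f2 :: "complex \<Rightarrow> real \<Rightarrow> complex"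
  assumes "0 < \<xi>" and "\<xi> < 1"
    and "admissible_index \<xi> nhat"
    and "Im kinf < 0" and "resonance \<xi> nhat kinf"
    and "open \<omega>" and "kinf \<in> \<omega>" and "\<omega> \<subseteq> {k. Im k < 0}"
    and "\<forall>k\<in>\<omega>. k * of_real (n2_one nhat) \<notin> hankel1_zeros"
    and "h1 holomorphic_on \<omega>" and "h2 holomorphic_on \<omega>"
    and "\<forall>k\<in>\<omega>. h1 k \<noteq> 0 \<and> h2 k \<noteq> 0"
    and "\<forall>k\<in>\<omega>. unique_solution_on {0<..<\<xi>} (F1_solution \<xi> nhat m k (h1 k)) (f1 k)"
    and "\<forall>k\<in>\<omega>. unique_solution_on {\<xi><..<1} (F2_solution \<xi> nhat m k (h2 k)) (f2 k)"
  shows "(\<forall>k\<in>\<omega>. coupling_det \<xi> f1 f2 k =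
            \<i> * k * of_real (n2_xi \<xi> nhat + n1_xi \<xi> nhat)
              * Lim (at_left \<xi>) (f1 k) * Lim (at_right \<xi>) (f2 k)
            + h2 k * Lim (at_left \<xi>) (f1 k) + h1 k * Lim (at_right \<xi>) (f2 k))
    \<and> coupling_det \<xi> f1 f2 analytic_on \<omega>
    \<and> (kinf \<noteq> 0 \<and> coupling_det \<xi> f1 f2 kinf = 0 \<and> deriv (coupling_det \<xi> f1 f2) kinf \<noteq> 0 \<longrightarrow>
        (\<exists>\<delta>>0. \<forall>k0\<in>ball kinf \<delta>. \<forall>ks. newton_sequence (coupling_det \<xi> f1 f2) k0 ks \<longrightarrow>
            (\<forall>l. ks l \<in> \<omega> \<and> deriv (coupling_det \<xi> f1 f2) (ks l) \<noteq> 0)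
            \<and> converges_quadratically ks kinf))"
proof -
  let ?det = "coupling_det \<xi> f1 f2"
  define a1 where "a1 = (\<lambda>k. Lim (at_left \<xi>) (f1 k))"
  define a2 where "a2 = (\<lambda>k. Lim (at_right \<xi>) (f2 k))"
  define c where "c = (\<lambda>k. of_nat (nat \<bar>m\<bar>) - dtn_symbol m (k * of_real (n2_one nhat)))"
  obtain C1 C2 where lip: "C1-lipschitz_on {0<..<\<xi>} nhat" "C2-lipschitz_on {\<xi><..<1} nhat"
    using assms(3) by (auto simp: admissible_index_def)
  obtain A D where F1: "A holomorphic_on UNIV" "D holomorphic_on UNIV"
    "\<And>k h v. F1_solution \<xi> nhat m k h v \<Longrightarrow> h \<noteq> 0 \<Longrightarrow> D k \<noteq> 0 \<and> Lim (at_left \<xi>) v = h * A k / D k"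
    by (rule F1_endpoint_value[OF assms(1) lip(1), of m]) (rule that; blast)
  obtain A1 A2 D1 D2 where F2: "A1 holomorphic_on UNIV" "A2 holomorphic_on UNIV"
    "D1 holomorphic_on UNIV" "D2 holomorphic_on UNIV"
    "\<And>k h v c. F2_solution \<xi> nhat m k h v \<Longrightarrow> h \<noteq> 0 \<Longrightarrow>
      c = of_nat (nat \<bar>m\<bar>) - dtn_symbol m (k * of_real (n2_one nhat)) \<Longrightarrow>
      D1 k + c * D2 k \<noteq> 0 \<and>
      Lim (at_right \<xi>) v = h * (A1 k + c * A2 k) / (D1 k + c * D2 k)"
    by (rule F2_endpoint_value[OF assms(1,2) lip(2), of m]) (rule that; blast)
  have sol: "F1_solution \<xi> nhat m k (h1 k) (f1 k)" "F2_solution \<xi> nhat m k (h2 k) (f2 k)"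
    "h1 k \<noteq> 0" "h2 k \<noteq> 0" if "k \<in> \<omega>" for k
    using assms(12-14) that by (auto simp: unique_solution_on_def)
  note eq1 = F1(3)[OF sol(1,3)]
  note eq2 = F2(5)[OF sol(2,4) c_def[THEN fun_cong]]
  \<comment> \<open>The inhomogeneous conditions at \<open>\<xi>\<close> express both derivatives
    through the values, which removes them from the Wronskian.\<close>
  have formula: "?det k = \<i> * k * of_real (n2_xi \<xi> nhat + n1_xi \<xi> nhat) * a1 k * a2 k
      + h2 k * a1 k + h1 k * a2 k" if k: "k \<in> \<omega>" for k
  proof -
    obtain a b where l: "has_endpoint_data (at_left \<xi>) (f1 k) a b"
      "b - \<i> * k * of_real (n1_xi \<xi> nhat) * a = h1 k"
      using sol(1)[OF k] by (auto simp: F1_solution_def)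
    obtain a' b' where r: "has_endpoint_data (at_right \<xi>) (f2 k) a' b'"
      "- b' - \<i> * k * of_real (n2_xi \<xi> nhat) * a' = h2 k"
      using sol(2)[OF k] by (auto simp: F2_solution_def)
    have l_eq: "Lim (at_left \<xi>) (f1 k) = a" "Lim (at_left \<xi>) (vderiv (f1 k)) = b"
      using l(1) by (auto simp: has_endpoint_data_def intro!: tendsto_Lim)
    have r_eq: "Lim (at_right \<xi>) (f2 k) = a'" "Lim (at_right \<xi>) (vderiv (f2 k)) = b'"
      using r(1) by (auto simp: has_endpoint_data_def intro!: tendsto_Lim)
    show ?thesis
      unfolding coupling_det_def a1_def a2_def l_eq r_eq l(2)[symmetric] r(2)[symmetric]
      by (simp add: algebra_simps)
  qed
  have "dtn_symbol m holomorphic_on (\<lambda>k. k * of_real (n2_one nhat)) ` \<omega>"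
  proof (rule holomorphic_dtn_symbol)
    have pos: "0 < n2_one nhat" by (rule n2_one_pos[OF assms(3,2,1)])
    then show "open ((\<lambda>k. k * complex_of_real (n2_one nhat)) ` \<omega>)"
      using open_scaling[of "n2_one nhat" \<omega>] assms(6)
      by (simp add: scaleR_conv_of_real mult.commute)
    show "Im z < 0" if "z \<in> (\<lambda>k. k * complex_of_real (n2_one nhat)) ` \<omega>" for z
      using that pos assms(8) by (auto simp: mult_neg_pos)
    show "z \<notin> hankel1_zeros" if "z \<in> (\<lambda>k. k * complex_of_real (n2_one nhat)) ` \<omega>" for z
      using that assms(9) by auto
  qed
  moreover have "(\<lambda>k. k * complex_of_real (n2_one nhat)) holomorphic_on \<omega>"
    by (intro holomorphic_intros)
  ultimately have "(\<lambda>k. dtn_symbol m (k * of_real (n2_one nhat))) holomorphic_on \<omega>"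
    using holomorphic_on_compose[unfolded o_def] by blast
  then have c: "c holomorphic_on \<omega>"
    unfolding c_def by (intro holomorphic_on_diff holomorphic_on_const)
  have sub: "f holomorphic_on UNIV \<Longrightarrow> f holomorphic_on \<omega>" for f :: "complex \<Rightarrow> complex"
    using holomorphic_on_subset by blast
  have "(\<lambda>k. h1 k * A k / D k) holomorphic_on \<omega>"
    using eq1 by (intro holomorphic_on_divide holomorphic_on_mult assms(10) sub F1(1,2)) blast
  \<comment> \<open>The quotient is holomorphic by construction and agrees with the true endpoint
    value throughout \<open>\<omega>\<close>.\<close>
  then have a1: "a1 holomorphic_on \<omega>"
    by (rule holomorphic_transform) (use eq1 in \<open>simp add: a1_def\<close>)
  have "(\<lambda>k. h2 k * (A1 k + c k * A2 k) / (D1 k + c k * D2 k)) holomorphic_on \<omega>"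
    using eq2 by (intro holomorphic_on_divide holomorphic_on_mult holomorphic_on_add
        assms(11) c sub F2(1-4)) blast
  then have a2: "a2 holomorphic_on \<omega>"
    by (rule holomorphic_transform) (use eq2 in \<open>simp add: a2_def\<close>)
  have "(\<lambda>k. \<i> * k * of_real (n2_xi \<xi> nhat + n1_xi \<xi> nhat) * a1 k * a2 k
      + h2 k * a1 k + h1 k * a2 k) holomorphic_on \<omega>"
    by (intro holomorphic_on_add holomorphic_on_mult holomorphic_on_const holomorphic_on_ident
        a1 a2 assms(10,11))
  then have det: "?det holomorphic_on \<omega>"
    by (rule holomorphic_transform) (simp add: formula)
  show ?thesis
  proof (intro conjI impI)
    show "\<forall>k\<in>\<omega>. ?det k = \<i> * k * of_real (n2_xi \<xi> nhat + n1_xi \<xi> nhat)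
        * Lim (at_left \<xi>) (f1 k) * Lim (at_right \<xi>) (f2 k)
        + h2 k * Lim (at_left \<xi>) (f1 k) + h1 k * Lim (at_right \<xi>) (f2 k)"
      using formula by (simp add: a1_def a2_def)
    show "?det analytic_on \<omega>"
      using det assms(6) by (simp add: analytic_on_open)
  qed (use newton_local_quadratic_convergence[OF det assms(6,7)] in blast)
qed

end
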